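(* There exists a positive integer $k_0$ such that for all $k \ge k_0$ the following holds. Every connected $n$-vertex graph $G$ with minimum degree at least $\frac{n}{k}\left(1+3\sqrt{\ln k/k}\right)$ satisfies $$c_k(G)^{1/n} \ge (1-o_n(1))\, d(G)^{1/n}\cdot z^*_k,$$ where $o_n(1)$ denotes a quantity tending to $0$ as $n\to\infty$ with $k$ fixed.
   Context: For a graph $G$, $c_k(G)$ denotes the number of spanning trees of $G$ with maximum degree at most $k$, and $d(G)$ denotes the product of the degrees of all vertices of $G$. Define $z^*_k = \left(1-\frac{1}{7k}\right)^{1-\frac{1}{7k}}\left(\frac{1}{9k}\right)^{\frac{1}{7k}}$. *)

theory Defs
  imports Complex_Main "Graph_Theory.Graph_Theory"
begin

text \<open>
  Finite simple graphs are the \<^locale>\<open>pair_graph\<close>s of the library: finite symmetric loopfree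
  digraphs without parallel arcs, so that an undirected edge \<open>{u, v}\<close> is the pair of arcs
  \<open>(u, v)\<close>, \<open>(v, u)\<close>.  In such a graph the degree of a vertex is its out-degree.
\<close>

abbreviation degree :: "'a pair_pre_digraph \<Rightarrow> 'a \<Rightarrow> nat" where
  "degree G v \<equiv> out_degree (with_proj G) v"

definition min_degree :: "'a pair_pre_digraph \<Rightarrow> nat" where
  "min_degree G = Min (degree G ` pverts G)"

definition max_degree :: "'a pair_pre_digraph \<Rightarrow> nat" where
  "max_degree G = Max (degree G ` pverts G)"

definition degree_prod :: "'a pair_pre_digraph \<Rightarrow> nat" where
  "degree_prod G = (\<Prod>v\<in>pverts G. degree G v)"

abbreviation connected_graph :: "'a pair_pre_digraph \<Rightarrow> bool" where
  "connected_graph G \<equiv> Digraph_Component.connected (with_proj G)"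

text \<open>
  The library's \<^const>\<open>tree\<close> and \<^const>\<open>spanning_tree\<close> forbid directed cycles of every length.
  A symmetric digraph with an edge always has the closed walk \<open>(u, v), (v, u)\<close>, while an acyclic
  orientation of any connected graph would count as a tree.  In a simple graph the undirected
  cycles are exactly the directed cycles with at least three arcs.
\<close>

definition tree_graph :: "'a pair_pre_digraph \<Rightarrow> bool" where
  "tree_graph T \<longleftrightarrow> pair_graph T \<and> connected_graph T \<and>
     \<not> (\<exists>p. pre_digraph.cycle (with_proj T) p \<and> 3 \<le> length p)"

definition bounded_spanning_trees :: "nat \<Rightarrow> 'a pair_pre_digraph \<Rightarrow> 'a pair_pre_digraph set" where
  "bounded_spanning_trees k G =
     {T. tree_graph T \<and> spanning (with_proj T) (with_proj G) \<and> max_degree T \<le> k}"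

definition num_bounded_spanning_trees :: "nat \<Rightarrow> 'a pair_pre_digraph \<Rightarrow> nat" where
  "num_bounded_spanning_trees k G = card (bounded_spanning_trees k G)"

lemma finite_bounded_spanning_trees:
  assumes "pair_graph G"
  shows "finite (bounded_spanning_trees k G)"
proof -
  interpret pair_graph G by (fact assms)
  have "T \<in> (\<lambda>A. \<lparr>pverts = pverts G, parcs = A\<rparr>) ` Pow (parcs G)"
    if "T \<in> bounded_spanning_trees k G" for T
  proof (rule image_eqI)
    show "T = \<lparr>pverts = pverts G, parcs = parcs T\<rparr>"
      using that by (simp add: bounded_spanning_trees_def spanning_def)
    show "parcs T \<in> Pow (parcs G)"
      using that by (simp add: bounded_spanning_trees_def spanning_def subgraph_def)
  qed
  then have "bounded_spanning_trees k G \<subseteq>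
      (\<lambda>A. \<lparr>pverts = pverts G, parcs = A\<rparr>) ` Pow (parcs G)"
    by blast
  then show ?thesis
    using finite_subset pair_finite_arcs by blast
qed

definition z_star :: "nat \<Rightarrow> real" where
  "z_star k = (1 - 1 / (7 * real k)) powr (1 - 1 / (7 * real k)) *
     (1 / (9 * real k)) powr (1 / (7 * real k))"

end

theory Submission
  imports Defs "HOL-Library.FuncSet" "HOL-Real_Asymp.Real_Asymp"
begin

text \<open>
  Let every vertex choose a uniformly random neighbour; there are \<open>d(G)\<close> outcomes.  The mean
  in-degree of a vertex is at most \<open>k / (1 + 3 \<surd>(ln k / k))\<close>, so by a Chernoff bound the total excess
  over \<open>k - 3\<close> is typically a small fraction of \<open>n / k\<close>, and a vertex lies on a cycle of length at
  most \<open>L\<close> with probability at most \<open>L k / n\<close>.  Hence for half of the outcomes one can delete the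
  choices of at most \<open>n / (100 k)\<close> vertices and be left with a rooted forest of in-degrees at most
  \<open>k - 2\<close>.  The deleted choices are then made again, one at a time and always for the root of a smallest
  tree, so that at least half of the neighbours stay permitted, until a number of trees independent of
  \<open>n\<close> remains.  These are joined by a bounded number of edge exchanges.

  Up to a factor polynomial in \<open>n\<close>, at most \<open>(200 k e)\<^bsup>n/(100k)\<^esup>\<close> is lost in the count.  This is
  exponentially smaller than the loss \<open>(1 / z_star k)\<^bsup>n\<^esup>\<close> that is allowed, so the polynomial factor is
  absorbed and the error term can be taken to vanish for all large \<open>n\<close>.
\<close>

section \<open>Undirected forests\<close>

text \<open>The difficulty is to turn selections into trees so that few selections lead to the same
  tree. A pruned forest \<open>E\<close> stands for at most \<open>weight E\<close> selections, the
  product of the degrees of its roots; choosing again among half of the neighbours returns this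
  weight up to a factor 2 per root. Inside the extended forest, the pruned one is determined by its
  root set. The rooted forest in turn is recovered from the final tree, the arcs changed and the
  roots. An in-degree of at most k - 2 together with the parent keeps every degree strictly below k.
  So, while the last trees are joined, a vertex of degree k must have received a new edge, and the
  number of such vertices is bounded independently of n. The excess is taken over k - 3 so that it
  also counts the vertices that have reached k - 2. The surplus 3 sqrt (ln k / k) in the minimum
  degree serves twice: it makes the Chernoff exponent about -2 ln k, and it lets k times the minimum
  degree exceed n by a margin linear in n, which forces an edge exchange at every saturated
  vertex.\<close>

text \<open>Acyclicity in the form that every edge is a bridge. Loops are excluded too, and
  deleting, inserting and exchanging edges become statements about \<open>rtrancl\<close>
  alone.\<close>

definition uforest :: "('a \<times> 'a) set \<Rightarrow> bool" where
  "uforest F \<longleftrightarrow> sym F \<and> (\<forall>u v. (u, v) \<in> F \<longrightarrow> (u, v) \<notin> (F - {(u, v), (v, u)})\<^sup>*)"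

lemma uforest_sym: "uforest F \<Longrightarrow> (u, v) \<in> F \<Longrightarrow> (v, u) \<in> F"
  by (auto simp: uforest_def dest: symD)

lemma uforest_bridge: "uforest F \<Longrightarrow> (u, v) \<in> F \<Longrightarrow> (u, v) \<notin> (F - {(u, v), (v, u)})\<^sup>*"
  by (auto simp: uforest_def)

lemma rtrancl_symD: "sym F \<Longrightarrow> (u, v) \<in> F\<^sup>* \<Longrightarrow> (v, u) \<in> F\<^sup>*"
  by (meson sym_rtrancl symD)

lemma sym_delete: "sym F \<Longrightarrow> sym (F - {(u, v), (v, u)})"
  by (auto simp: sym_def)

lemma uforest_delete:
  assumes "uforest F"
  shows "uforest (F - {(u, v), (v, u)})"
  unfolding uforest_def
proof (intro conjI allI impI)
  show "sym (F - {(u, v), (v, u)})" using assms by (simp add: uforest_def sym_delete)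
  fix x y assume xy: "(x, y) \<in> F - {(u, v), (v, u)}"
  have "F - {(u, v), (v, u)} - {(x, y), (y, x)} \<subseteq> F - {(x, y), (y, x)}" by auto
  then show "(x, y) \<notin> (F - {(u, v), (v, u)} - {(x, y), (y, x)})\<^sup>*"
    using uforest_bridge[OF assms, of x y] xy rtrancl_mono by blast
qed

text \<open>A walk that crosses the new edge several times can be shortened to one that crosses it
  at most once.\<close>

lemma rtrancl_insert_edgeE:
  assumes "(x, y) \<in> (F \<union> {(a, b), (b, a)})\<^sup>*"
  shows "(x, y) \<in> F\<^sup>* \<or> (x, a) \<in> F\<^sup>* \<and> (b, y) \<in> F\<^sup>* \<or> (x, b) \<in> F\<^sup>* \<and> (a, y) \<in> F\<^sup>*"
  using assms
proof induction
  case (step y z)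
  then show ?case by (auto intro: rtrancl_into_rtrancl rtrancl_trans)
qed simp

text \<open>If an old edge (u, v) had a detour through the new edge, the two outer pieces of the
  detour and (u, v) itself would link a and b inside \<open>F\<close>.\<close>

lemma uforest_insert:
  assumes F: "uforest F" and ab: "(a, b) \<notin> F\<^sup>*"
  shows "uforest (F \<union> {(a, b), (b, a)})"
proof -
  have symF: "sym F" using F by (simp add: uforest_def)
  have no: "(b, a) \<notin> F\<^sup>*" using rtrancl_symD[OF symF] ab by blast
  let ?F = "F \<union> {(a, b), (b, a)}"
  have "(u, v) \<notin> (?F - {(u, v), (v, u)})\<^sup>*" if uv: "(u, v) \<in> ?F" for u v
  proof
    assume *: "(u, v) \<in> (?F - {(u, v), (v, u)})\<^sup>*"
    show False
    proof (cases "(u, v) \<in> {(a, b), (b, a)}")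
      case True
      then have "(?F - {(u, v), (v, u)}) \<subseteq> F" by auto
      then have "(u, v) \<in> F\<^sup>*" using * rtrancl_mono by blast
      then show False using True ab no by auto
    next
      case False
      then have uvF: "(u, v) \<in> F" "(v, u) \<in> F" using uv uforest_sym[OF F] by auto
      let ?D = "F - {(u, v), (v, u)}"
      have "?F - {(u, v), (v, u)} \<subseteq> ?D \<union> {(a, b), (b, a)}" by auto
      then have "(u, v) \<in> (?D \<union> {(a, b), (b, a)})\<^sup>*" using * rtrancl_mono by blast
      then have "(u, v) \<in> ?D\<^sup>* \<or> (u, a) \<in> ?D\<^sup>* \<and> (b, v) \<in> ?D\<^sup>* \<or> (u, b) \<in> ?D\<^sup>* \<and> (a, v) \<in> ?D\<^sup>*"
        by (rule rtrancl_insert_edgeE)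
      moreover have "(u, v) \<notin> ?D\<^sup>*" using uforest_bridge[OF F uvF(1)] .
      moreover have "x \<in> F\<^sup>*" if "x \<in> ?D\<^sup>*" for x
        using that rtrancl_mono[of ?D F] by blast
      ultimately have "(u, a) \<in> F\<^sup>* \<and> (b, v) \<in> F\<^sup>* \<or> (u, b) \<in> F\<^sup>* \<and> (a, v) \<in> F\<^sup>*"
        by metis
      moreover have "(u, v) \<in> F\<^sup>*" "(v, u) \<in> F\<^sup>*" using uvF by auto
      ultimately show False using ab no symF by (meson rtrancl_symD rtrancl_trans)
    qed
  qed
  then show ?thesis using symF unfolding uforest_def by (auto simp: sym_def)
qed

section \<open>Branches of a forest at a vertex\<close>

text \<open>The branch at \<open>u\<close> through \<open>w\<close>: the component of
  \<open>w\<close> once the edge between them is cut.\<close>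

definition side :: "('a \<times> 'a) set \<Rightarrow> 'a \<Rightarrow> 'a \<Rightarrow> 'a set" where
  "side F u w = (F - {(u, w), (w, u)})\<^sup>* `` {w}"

lemma side_self: "w \<in> side F u w"
  by (simp add: side_def)

lemma side_connected: "x \<in> side F u w \<Longrightarrow> (w, x) \<in> F\<^sup>*"
  unfolding side_def using rtrancl_mono[of "F - {(u, w), (w, u)}" F] by auto

lemma side_not_base:
  assumes "uforest F" "(u, w) \<in> F"
  shows "u \<notin> side F u w"
proof
  assume "u \<in> side F u w"
  then have "(w, u) \<in> (F - {(w, u), (u, w)})\<^sup>*" by (simp add: side_def insert_commute)
  then show False using uforest_bridge[OF assms(1) uforest_sym[OF assms]] by simp
qed

text \<open>A branch never returns to its base, so walks in it miss the vertex \<open>u\<close> and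
  not only the edge that was cut. In this form branches cut off by different edges can be
  compared.\<close>

lemma side_avoids_base:
  assumes F: "uforest F" and uw: "(u, w) \<in> F" and x: "x \<in> side F u w"
  shows "(w, x) \<in> (F - {u} \<times> UNIV - UNIV \<times> {u})\<^sup>*"
proof -
  have "(w, x) \<in> (F - {(u, w), (w, u)})\<^sup>*" using x by (simp add: side_def)
  then show ?thesis
  proof induction
    case (step y z)
    have "y \<in> side F u w" "z \<in> side F u w"
      using step.hyps rtrancl_into_rtrancl[OF step.hyps] by (simp_all add: side_def)
    then have "y \<noteq> u" "z \<noteq> u" using side_not_base[OF F uw] by auto
    then show ?case using step by (auto intro: rtrancl_into_rtrancl)
  qed simp
qed

lemma side_subset:
  assumes F: "uforest F" and uw: "(u, w) \<in> F" and wv: "(w, v) \<in> F" and "v \<noteq> u"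
  shows "side F w v \<subseteq> side F u w - {w}"
proof
  fix x assume x: "x \<in> side F w v"
  have "(v, x) \<in> (F - {w} \<times> UNIV - UNIV \<times> {w})\<^sup>*" using side_avoids_base[OF F wv x] .
  moreover have "F - {w} \<times> UNIV - UNIV \<times> {w} \<subseteq> F - {(u, w), (w, u)}" by auto
  ultimately have "(v, x) \<in> (F - {(u, w), (w, u)})\<^sup>*" using rtrancl_mono by blast
  moreover have "(w, v) \<in> F - {(u, w), (w, u)}" using wv uforest_sym[OF F uw] \<open>v \<noteq> u\<close>
    by auto
  ultimately have "x \<in> side F u w" by (auto simp: side_def intro: converse_rtrancl_into_rtrancl)
  moreover have "x \<noteq> w" using side_not_base[OF F wv] x by auto
  ultimately show "x \<in> side F u w - {w}" by simp
qed

lemma side_disjoint: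
  assumes F: "uforest F" and uw: "(u, w) \<in> F" and uv: "(u, v) \<in> F" and "v \<noteq> w"
  shows "side F u w \<inter> side F u v = {}"
proof (rule ccontr)
  assume "\<not> ?thesis"
  then obtain x where x: "x \<in> side F u w" "x \<in> side F u v" by auto
  let ?G = "F - {u} \<times> UNIV - UNIV \<times> {u}"
  have sF: "sym F" using F by (simp add: uforest_def)
  then have "sym ?G" by (auto simp: sym_def)
  then have "(w, v) \<in> ?G\<^sup>*"
    using side_avoids_base[OF F uw x(1)] side_avoids_base[OF F uv x(2)]
    by (meson rtrancl_symD rtrancl_trans)
  moreover have "?G \<subseteq> F - {(u, w), (w, u)}" by auto
  ultimately have "(w, v) \<in> (F - {(u, w), (w, u)})\<^sup>*" using rtrancl_mono by blast
  moreover have "(v, u) \<in> F - {(u, w), (w, u)}" using uforest_sym[OF F uv] \<open>v \<noteq> w\<close>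
    side_not_base[OF F uv] side_self[of v F u] by auto
  ultimately have "(w, u) \<in> (F - {(u, w), (w, u)})\<^sup>*" by (rule rtrancl_into_rtrancl)
  then have "u \<in> side F u w" by (simp add: side_def)
  then show False using side_not_base[OF F uw] by simp
qed

text \<open>Stepping from \<open>w\<close> to a neighbour other than \<open>u\<close> leads into a
  strictly smaller branch by \<open>side_subset\<close>; if there is no such neighbour,
  \<open>w\<close> itself is a leaf.\<close>

lemma side_has_leaf:
  assumes F: "uforest F" and fin: "finite F" and uw: "(u, w) \<in> F"
  shows "\<exists>x\<in>side F u w. card (F `` {x}) \<le> 1"
  using uw
proof (induction "card (side F u w)" arbitrary: u w rule: less_induct)
  case less
  have fs: "finite (side F u w)"
  proof -
    have "side F u w \<subseteq> insert w (snd ` F)"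
    proof
      fix x assume "x \<in> side F u w"
      then have "(w, x) \<in> (F - {(u, w), (w, u)})\<^sup>*" by (simp add: side_def)
      then show "x \<in> insert w (snd ` F)" by cases force+
    qed
    then show ?thesis using fin finite_subset by blast
  qed
  show ?case
  proof (cases "\<exists>v. (w, v) \<in> F \<and> v \<noteq> u")
    case True
    then obtain v where v: "(w, v) \<in> F" "v \<noteq> u" by auto
    have sub: "side F w v \<subseteq> side F u w - {w}" using side_subset[OF F less.prems v] .
    then have "side F w v \<subset> side F u w" using side_self[of w F u] by auto
    then have "card (side F w v) < card (side F u w)" using fs psubset_card_mono by blast
    from less.hyps[OF this v(1)] sub show ?thesis by auto
  next
    case False
    then have "F `` {w} \<subseteq> {u}" by auto
    then have "card (F `` {w}) \<le> card {u}" by (intro card_mono) auto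
    then show ?thesis using side_self[of w F u] by auto
  qed
qed

lemma in_side_or_base:
  assumes "(w, y) \<in> F\<^sup>*"
  shows "y \<in> side F u w \<or> (u, y) \<in> (F - {(u, w), (w, u)})\<^sup>*"
proof -
  have "F \<subseteq> (F - {(u, w), (w, u)}) \<union> {(u, w), (w, u)}" by auto
  then have "(w, y) \<in> ((F - {(u, w), (w, u)}) \<union> {(u, w), (w, u)})\<^sup>*" using assms rtrancl_mono by blast
  then show ?thesis using rtrancl_insert_edgeE[of w y "F - {(u, w), (w, u)}" u w] by (auto simp: side_def)
qed

text \<open>Cutting a bridge splits one component into two halves, and any edge between the halves
  glues it together again.\<close>

lemma uforest_swap:
  assumes F: "uforest F" and uw: "(u, w) \<in> F" and a: "a \<in> side F u w"
    and ab: "(a, b) \<in> F\<^sup>*" and b: "b \<notin> side F u w"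
  defines "F' \<equiv> (F - {(u, w), (w, u)}) \<union> {(a, b), (b, a)}"
  shows "uforest F'" and "F'\<^sup>* = F\<^sup>*"
proof -
  let ?D = "F - {(u, w), (w, u)}"
  have sF: "sym F" and sD: "sym ?D" using F uforest_delete[OF F] by (auto simp: uforest_def)
  have "(a, b) \<notin> ?D\<^sup>*" using a b unfolding side_def by (auto intro: rtrancl_trans)
  then show F': "uforest F'" unfolding F'_def by (intro uforest_insert uforest_delete F)
  then have sF': "sym F'" by (simp add: uforest_def)
  have "F' \<subseteq> F\<^sup>*" using ab rtrancl_symD[OF sF ab] unfolding F'_def by auto
  then have 1: "F'\<^sup>* \<subseteq> F\<^sup>*" by (metis rtrancl_mono rtrancl_idemp)
  have "(w, b) \<in> F\<^sup>*" using side_connected[OF a] ab by (rule rtrancl_trans)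
  then have "(u, b) \<in> ?D\<^sup>*" using in_side_or_base b by fast
  moreover have "?D\<^sup>* \<subseteq> F'\<^sup>*" by (rule rtrancl_mono) (auto simp: F'_def)
  moreover have "(w, a) \<in> ?D\<^sup>*" using a by (simp add: side_def)
  moreover have "(a, b) \<in> F'\<^sup>*" by (auto simp: F'_def)
  ultimately have "(w, u) \<in> F'\<^sup>*" by (meson subsetD rtrancl_symD[OF sF'] rtrancl_trans)
  then have "F \<subseteq> F'\<^sup>*" using rtrancl_symD[OF sF'] by (auto simp: F'_def)
  then have "F\<^sup>* \<subseteq> F'\<^sup>*" by (metis rtrancl_mono rtrancl_idemp)
  with 1 show "F'\<^sup>* = F\<^sup>*" by blast
qed


section \<open>Trees in the library and orientations\<close>

lemma single_valued_joinable:
  assumes "single_valued E" "(x, y) \<in> (E \<union> E\<inverse>)\<^sup>*"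
  shows "\<exists>z. (x, z) \<in> E\<^sup>* \<and> (y, z) \<in> E\<^sup>*"
  using assms(2)
proof induction
  case (step y y')
  then obtain z where z: "(x, z) \<in> E\<^sup>*" "(y, z) \<in> E\<^sup>*" by blast
  show ?case
  proof (cases "(y, y') \<in> E")
    case True
    then have "(y, y') \<in> E\<^sup>*" by simp
    from single_valued_confluent[OF assms(1) z(2) this] show ?thesis
      using z by (meson rtrancl_trans rtrancl.rtrancl_refl)
  next
    case False
    then have "(y', y) \<in> E" using step by auto
    then show ?thesis using z by (meson converse_rtrancl_into_rtrancl)
  qed
qed blast

text \<open>Without the arc (u, v) the vertex u has no successor. A detour from u to v would make
  the forward paths of u and v meet, necessarily in u, so v would reach u and (u, v) would close a
  directed cycle.\<close>

lemma uforest_of_acyclic: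
  assumes sv: "single_valued E" and ac: "acyclic E"
  shows "uforest (E \<union> E\<inverse>)"
proof -
  have key: "(u, v) \<notin> (E \<union> E\<inverse> - {(u, v), (v, u)})\<^sup>*" if uv: "(u, v) \<in> E" for u v
  proof
    let ?E = "E - {(u, v)}"
    assume "(u, v) \<in> (E \<union> E\<inverse> - {(u, v), (v, u)})\<^sup>*"
    moreover have "E \<union> E\<inverse> - {(u, v), (v, u)} \<subseteq> ?E \<union> ?E\<inverse>" by auto
    ultimately have "(u, v) \<in> (?E \<union> ?E\<inverse>)\<^sup>*" by (metis rtrancl_mono subsetD)
    moreover have "single_valued ?E" by (rule single_valued_subset[OF _ sv]) auto
    ultimately obtain z where z: "(u, z) \<in> ?E\<^sup>*" "(v, z) \<in> ?E\<^sup>*"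
      using single_valued_joinable[of ?E u v] by auto
    have "u \<notin> Domain ?E" using sv uv by (auto dest: single_valuedD)
    then have "z = u" using z(1) by (metis Domain_iff converse_rtranclE)
    then have "(v, u) \<in> ?E\<^sup>*" using z by simp
    then have "(v, u) \<in> E\<^sup>*" using rtrancl_mono[of ?E E] by blast
    then have "(u, u) \<in> E\<^sup>+" using uv by (meson rtrancl_into_trancl2)
    then show False using ac by (simp add: acyclic_def)
  qed
  have "sym (E \<union> E\<inverse>)" by (auto simp: sym_def)
  moreover have "(u, v) \<notin> (E \<union> E\<inverse> - {(u, v), (v, u)})\<^sup>*" if "(u, v) \<in> E \<union> E\<inverse>" for u v
  proof (cases "(u, v) \<in> E")
    case True
    then show ?thesis by (rule key)
  next
    case False
    then have "(v, u) \<notin> (E \<union> E\<inverse> - {(u, v), (v, u)})\<^sup>*"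
      using that key[of v u] by (simp add: insert_commute)
    moreover have "sym (E \<union> E\<inverse> - {(u, v), (v, u)})" by (auto simp: sym_def)
    ultimately show ?thesis using rtrancl_symD by metis
  qed
  ultimately show ?thesis by (simp add: uforest_def)
qed

text \<open>If \<open>E'\<close> reverses an arc (a, b) of \<open>E\<close>, then b has a successor
  in \<open>E'\<close>, hence also in \<open>E\<close>, while \<open>E'\<close> has already spent
  the only out-arc of b on a. So the next arc towards the root is reversed as well, and this cannot
  go on forever. Consequently the undirected edges together with the roots determine a rooted
  forest.\<close>

lemma orientation_subset:
  assumes fin: "finite E" and ac: "acyclic E" and sv: "single_valued E'"
    and dom: "Domain E = Domain E'" and eq: "E \<union> E\<inverse> = E' \<union> E'\<inverse>"
  shows "E \<subseteq> E'"
proof -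
  have wf: "wf (E\<inverse>)" using fin ac by (rule finite_acyclic_wf_converse)
  have no: "\<not> ((a, b) \<in> E \<and> (b, a) \<in> E')" for a b
    using wf
  proof (induction b arbitrary: a rule: wf_induct_rule)
    case (less b)
    show ?case
    proof
      assume ab: "(a, b) \<in> E \<and> (b, a) \<in> E'"
      then obtain c where c: "(b, c) \<in> E" using dom by blast
      have "c \<noteq> a" using ab c ac
        by (meson acyclic_def r_into_trancl' trancl_into_trancl)
      then have "(b, c) \<notin> E'" using ab sv by (auto dest: single_valuedD)
      then have "(c, b) \<in> E'" using c eq by blast
      then show False using less[of c b] c by auto
    qed
  qed
  show ?thesis
  proof
    fix e assume "e \<in> E"
    then show "e \<in> E'" using no eq by (cases e) blast
  qed
qed

lemma orientation_unique:
  assumes "finite E" "acyclic E" "single_valued E" "finite E'" "acyclic E'" "single_valued E'"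
    and "Domain E = Domain E'" "E \<union> E\<inverse> = E' \<union> E'\<inverse>"
  shows "E = E'"
  using orientation_subset[of E E'] orientation_subset[of E' E] assms by auto

section \<open>Library graphs versus arc sets\<close>

lemma pcas_rtrancl: "pcas x es y \<Longrightarrow> set es \<subseteq> F \<Longrightarrow> (x, y) \<in> F\<^sup>*"
proof (induction es arbitrary: x)
  case (Cons e es)
  then have "(x, snd e) \<in> F" "(snd e, y) \<in> F\<^sup>*" by (auto intro: prod.collapse)
  then show ?case by (rule converse_rtrancl_into_rtrancl)
qed simp

lemma pawalk_verts_ends: "pcas x es y \<Longrightarrow> x \<in> set (pawalk_verts x es) \<and> y \<in> set (pawalk_verts x es)"
  by (induction es arbitrary: x) auto

lemma pawalk_verts_arcs:
  "pcas x es y \<Longrightarrow> e \<in> set es \<Longrightarrow> fst e \<in> set (pawalk_verts x es) \<and> snd e \<in> set (pawalk_verts x es)"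
proof (induction es arbitrary: x)
  case (Cons a es)
  then show ?case using pawalk_verts_ends[of "snd a" es y] by auto
qed simp

text \<open>After the first two arcs (u, v) and (v, w), the rest of the cycle leads from w back to u
  and misses v, so it bypasses the edge between u and v. Length at least 3 makes this rest
  non-empty, which gives w \<noteq> u.\<close>

lemma uforest_no_cycle:
  assumes F: "uforest F"
  shows "\<not> (\<exists>p. pre_digraph.cycle (with_proj \<lparr>pverts = V, parcs = F\<rparr>) p \<and> 3 \<le> length p)"
proof
  let ?T = "\<lparr>pverts = V, parcs = F\<rparr>"
  assume "\<exists>p. pre_digraph.cycle (with_proj ?T) p \<and> 3 \<le> length p"
  then obtain p u where p: "set p \<subseteq> F" "pcas u p u" "distinct (tl (pawalk_verts u p))" "3 \<le> length p"
    by (auto simp: pre_digraph.cycle_def pre_digraph.awalk_def cas_with_proj_eq awalk_verts_with_proj_eq)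
  then obtain e1 e2 e3 es where pe: "p = e1 # e2 # e3 # es"
    by (auto simp: numeral_3_eq_3 Suc_le_length_iff)
  obtain v where e1: "e1 = (u, v)" using p(2) pe by (cases e1) auto
  obtain w where e2: "e2 = (v, w)" using p(2) pe e1 by (cases e2) auto
  let ?q = "e3 # es"
  have q: "pcas w ?q u" "set ?q \<subseteq> F" "v \<notin> set (pawalk_verts w ?q)" "distinct (pawalk_verts w ?q)"
    using p pe e1 e2 by auto
  have "u \<in> set (pawalk_verts (snd e3) es)" using q(1) pawalk_verts_ends[of "snd e3" es u] by auto
  then have wu: "w \<noteq> u" using q(1,4) by auto
  have vu: "v \<noteq> u" using q(1,3) pawalk_verts_ends[of w ?q u] by auto
  have "(u, v) \<notin> set ?q" "(v, u) \<notin> set ?q"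
    using pawalk_verts_arcs[OF q(1)] q(3) by (metis fst_conv snd_conv)+
  then have "set ?q \<subseteq> F - {(v, u), (u, v)}" using q(2) by blast
  from pcas_rtrancl[OF q(1) this] have "(w, u) \<in> (F - {(v, u), (u, v)})\<^sup>*" .
  moreover have "(v, w) \<in> F - {(v, u), (u, v)}" using p(1) pe e2 wu vu by auto
  ultimately have "(v, u) \<in> (F - {(v, u), (u, v)})\<^sup>*" by (meson converse_rtrancl_into_rtrancl)
  moreover have "(v, u) \<in> F" using p(1) pe e1 uforest_sym[OF F] by auto
  ultimately show False using uforest_bridge[OF F] by blast
qed

lemma uforest_irrefl: "uforest F \<Longrightarrow> (u, u) \<notin> F"
  using uforest_bridge by fast

lemma pair_graph_uforest:
  assumes F: "uforest F" and V: "finite V" "F \<subseteq> V \<times> V"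
  shows "pair_graph \<lparr>pverts = V, parcs = F\<rparr>"
proof -
  have "finite F" using V finite_subset by blast
  moreover have "sym F" using F by (simp add: uforest_def)
  ultimately show ?thesis using V uforest_irrefl[OF F] by unfold_locales (auto simp: symmetric_def)
qed

lemma connected_graphI:
  assumes "V \<noteq> {}" "F \<subseteq> V \<times> V" "\<And>u v. u \<in> V \<Longrightarrow> v \<in> V \<Longrightarrow> (u, v) \<in> F\<^sup>*"
  shows "connected_graph \<lparr>pverts = V, parcs = F\<rparr>"
proof -
  let ?H = "mk_symmetric (with_proj \<lparr>pverts = V, parcs = F\<rparr>)"
  have p: "pverts ?H = V" "F \<subseteq> parcs ?H" "parcs ?H \<subseteq> V \<times> V"
    using assms(2) by (force simp: mk_symmetric_def)+
  have "(u, v) \<in> rtrancl_on V (parcs ?H)" if "u \<in> V" "v \<in> V" for u v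
  proof -
    have "(u, v) \<in> (parcs ?H)\<^sup>*" using assms(3)[OF that] rtrancl_mono[OF p(2)] by blast
    then show ?thesis using p(3) that by (intro rtrancl_consistent_rtrancl_on) auto
  qed
  then show ?thesis using assms(1) p
    by (auto simp: Digraph_Component.connected_def strongly_connected_def reachable_def)
qed

lemma connected_graphD:
  assumes "pair_graph G" "connected_graph G" "u \<in> pverts G" "v \<in> pverts G"
  shows "(u, v) \<in> (parcs G)\<^sup>*"
proof -
  interpret pair_graph G by fact
  let ?H = "mk_symmetric (with_proj G)"
  have "parcs ?H = parcs G" using arcs_symmetric by (force simp: mk_symmetric_def)
  moreover have "pverts ?H = pverts G" by (simp add: mk_symmetric_def)
  ultimately show "(u, v) \<in> (parcs G)\<^sup>*"
    using assms(2-4) reachable_rtranclI[of "with_proj ?H" u v]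
    by (simp add: Digraph_Component.connected_def strongly_connected_def)
qed

lemma connected_graph_nonempty: "connected_graph G \<Longrightarrow> pverts G \<noteq> {}"
  by (simp add: Digraph_Component.connected_def strongly_connected_def mk_symmetric_def)

lemma degree_eq_card_Image: "degree G v = card (parcs G `` {v})"
proof -
  have "out_arcs (with_proj G) v = Pair v ` (parcs G `` {v})"
    by (auto simp: out_arcs_def)
  then show ?thesis by (simp add: out_degree_def card_image inj_on_def)
qed

lemma bounded_spanning_treeI:
  assumes G: "pair_graph G" and V: "pverts G \<noteq> {}" and F: "uforest F" "F \<subseteq> parcs G"
    and conn: "\<And>u v. u \<in> pverts G \<Longrightarrow> v \<in> pverts G \<Longrightarrow> (u, v) \<in> F\<^sup>*"
    and deg: "\<And>v. card (F `` {v}) \<le> k"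
  shows "\<lparr>pverts = pverts G, parcs = F\<rparr> \<in> bounded_spanning_trees k G"
proof -
  interpret G: pair_graph G by fact
  let ?T = "\<lparr>pverts = pverts G, parcs = F\<rparr>"
  have FV: "F \<subseteq> pverts G \<times> pverts G" using F(2) G.wellformed' by auto
  have T: "pair_graph ?T" using pair_graph_uforest[OF F(1) G.pair_finite_verts FV] .
  then interpret T: pair_graph ?T .
  have "tree_graph ?T" unfolding tree_graph_def
    using T connected_graphI[OF V FV conn] uforest_no_cycle[OF F(1)] by blast
  moreover have "spanning (with_proj ?T) (with_proj G)"
    unfolding spanning_def subgraph_def compatible_def wf_digraph_wp_iff with_proj_simps
    using F(2) G.pair_wf_digraph T.pair_wf_digraph by (intro conjI) simp_all
  moreover have "max_degree ?T \<le> k"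
  proof -
    have "degree ?T v \<le> k" for v
      unfolding degree_eq_card_Image using deg[of v] by simp
    then show ?thesis
      unfolding max_degree_def using V G.pair_finite_verts by (subst Max_le_iff) auto
  qed
  ultimately show ?thesis unfolding bounded_spanning_trees_def by blast
qed


section \<open>Joining the components of a forest\<close>

locale host_graph =
  fixes V :: "'a set" and A :: "('a \<times> 'a) set"
  assumes finite_V: "finite V" and A_subset: "A \<subseteq> V \<times> V"
    and sym_A: "sym A" and irrefl_A: "(u, u) \<notin> A"
begin

lemma finite_A: "finite A"
  using A_subset finite_V finite_subset by blast

lemma finite_sub: "F \<subseteq> A \<Longrightarrow> finite F"
  using finite_A finite_subset by blast

lemma finite_Image: "F \<subseteq> A \<Longrightarrow> finite (F `` X)"
  using finite_sub finite_Image by blast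

lemma A_sym: "(u, v) \<in> A \<Longrightarrow> (v, u) \<in> A"
  using sym_A by (rule symD)

lemma A_V: "(u, v) \<in> A \<Longrightarrow> u \<in> V \<and> v \<in> V"
  using A_subset by auto

lemma finite_saturated:
  assumes "F \<subseteq> A" "k > 0"
  shows "finite {x. k \<le> card (F `` {x})}"
proof (rule finite_subset[OF _ finite_V], rule subsetI)
  fix x assume "x \<in> {x. k \<le> card (F `` {x})}"
  then have "F `` {x} \<noteq> {}" using assms(2) by auto
  then show "x \<in> V" using assms(1) A_V by blast
qed

lemma rtrancl_V: "F \<subseteq> A \<Longrightarrow> (u, v) \<in> F\<^sup>* \<Longrightarrow> u \<in> V \<Longrightarrow> v \<in> V"
  by (erule rtranclE) (auto dest: A_V)

definition tame_forest :: "nat \<Rightarrow> ('a \<times> 'a) set \<Rightarrow> bool" where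
  "tame_forest k F \<longleftrightarrow> uforest F \<and> F \<subseteq> A \<and> (\<forall>x. card (F `` {x}) \<le> k)"

text \<open>If no swap existed, then each of the \<open>k\<close> sides at a saturated vertex would contain a leaf
  together with almost all of its neighbours, which needs more than \<open>|V|\<close> vertices.\<close>

lemma swap_exists:
  assumes F: "tame_forest k F" and k: "k \<ge> 2" and u: "k \<le> card (F `` {u})"
    and D: "D = {x. k \<le> card (F `` {x})}" and M: "card D \<le> M"
    and H: "\<And>x y. (x, y) \<in> A \<Longrightarrow> x \<notin> D \<Longrightarrow> y \<notin> D \<Longrightarrow> (x, y) \<in> F\<^sup>*"
    and \<delta>: "\<And>v. v \<in> V \<Longrightarrow> \<delta> \<le> card (A `` {v})" "card V < k * (\<delta> - M)"
  shows "\<exists>w a b. (u, w) \<in> F \<and> a \<in> side F u w \<and> (a, b) \<in> A \<and> (a, b) \<in> F\<^sup>* \<and> b \<notin> side F u w \<and>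
    a \<notin> D \<and> b \<notin> D"
proof (rule ccontr)
  assume no: "\<not> ?thesis"
  have uf: "uforest F" and FA: "F \<subseteq> A" using F by (auto simp: tame_forest_def)
  have sV: "side F u w \<subseteq> V" if "(u, w) \<in> F" for w
  proof
    fix x assume "x \<in> side F u w"
    then have "(w, x) \<in> F\<^sup>*" by (rule side_connected)
    moreover have "w \<in> V" using that FA A_V by blast
    ultimately show "x \<in> V" using rtrancl_V FA by blast
  qed
  have finD: "finite D" using finite_saturated[OF FA, of k] k by (simp add: D)
  have big: "\<delta> - M \<le> card (side F u w)" if w: "w \<in> F `` {u}" for w
  proof -
    have uw: "(u, w) \<in> F" using w by auto
    obtain x where x: "x \<in> side F u w" "card (F `` {x}) \<le> 1"
      using side_has_leaf[OF uf finite_sub[OF FA] uw] by auto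
    have xD: "x \<notin> D" using x k by (auto simp: D)
    \<comment> \<open>By \<open>H\<close> an unsaturated neighbour of the leaf x lies in the same
      component, and then, as no exchange is available, in the same branch.\<close>
    have "A `` {x} \<subseteq> side F u w \<union> D"
    proof
      fix y assume "y \<in> A `` {x}"
      then have xy: "(x, y) \<in> A" by auto
      show "y \<in> side F u w \<union> D" using no uw x xy xD H[OF xy xD] by blast
    qed
    then have "card (A `` {x}) \<le> card (side F u w \<union> D)"
      using finite_subset[OF sV[OF uw] finite_V] finD by (intro card_mono) auto
    also have "\<dots> \<le> card (side F u w) + card D" by (rule card_Un_le)
    finally show ?thesis using \<delta>(1)[of x] x sV[OF uw] M by auto
  qed
  have "k * (\<delta> - M) \<le> card (F `` {u}) * (\<delta> - M)" using u by simp
  also have "\<dots> = (\<Sum>w\<in>F `` {u}. \<delta> - M)" by simp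
  also have "\<dots> \<le> (\<Sum>w\<in>F `` {u}. card (side F u w))" by (intro sum_mono big)
  also have "\<dots> = card (\<Union>w\<in>F `` {u}. side F u w)"
  proof (intro card_UN_disjoint[symmetric] ballI impI)
    show "finite (F `` {u})" using finite_Image[OF FA] .
    show "finite (side F u w)" if "w \<in> F `` {u}" for w
      using that sV finite_V finite_subset by blast
    show "side F u w \<inter> side F u v = {}" if "w \<in> F `` {u}" "v \<in> F `` {u}" "w \<noteq> v" for w v
      using that side_disjoint[OF uf] by blast
  qed
  also have "\<dots> \<le> card V" using sV finite_V by (intro card_mono) auto
  finally show False using \<delta>(2) by simp
qed

text \<open>Assumption \<open>H\<close> says that no two components can be joined directly at
  unsaturated vertices. One exchange then lowers the degree of \<open>u\<close>, and only the two
  ends of the new edge can become saturated. All changes stay inside the component of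
  \<open>u\<close>, so that two vertices in different components can be relieved one after the
  other. Differences count arcs, two per edge, hence the 4.\<close>

lemma relieve:
  assumes F: "tame_forest k F" and k: "k \<ge> 2"
    and D: "D = {x. k \<le> card (F `` {x})}" and M: "card D \<le> M"
    and H: "\<And>x y. (x, y) \<in> A \<Longrightarrow> x \<notin> D \<Longrightarrow> y \<notin> D \<Longrightarrow> (x, y) \<in> F\<^sup>*"
    and \<delta>: "\<And>v. v \<in> V \<Longrightarrow> \<delta> \<le> card (A `` {v})" "card V < k * (\<delta> - M)"
  shows "\<exists>F'. tame_forest k F' \<and> F'\<^sup>* = F\<^sup>* \<and> card (F' `` {u}) < k \<and>
    (\<forall>x. (u, x) \<notin> F\<^sup>* \<longrightarrow> F' `` {x} = F `` {x}) \<and> card ((F' - F) \<union> (F - F')) \<le> 4 \<and>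
    card {x. k \<le> card (F' `` {x})} \<le> card D + 2"
proof (cases "k \<le> card (F `` {u})")
  case False
  then show ?thesis using F by (intro exI[of _ F]) (auto simp: D)
next
  case True
  have uf: "uforest F" and FA: "F \<subseteq> A" and deg: "\<And>x. card (F `` {x}) \<le> k"
    using F by (auto simp: tame_forest_def)
  have sF: "sym F" using uf by (simp add: uforest_def)
  obtain w a b where uw: "(u, w) \<in> F" and a: "a \<in> side F u w" and abA: "(a, b) \<in> A"
    and ab: "(a, b) \<in> F\<^sup>*" and b: "b \<notin> side F u w" and nD: "a \<notin> D" "b \<notin> D"
    using swap_exists[OF F k True D M H \<delta>] by blast
  define F' where "F' = (F - {(u, w), (w, u)}) \<union> {(a, b), (b, a)}"
  have swap: "uforest F'" "F'\<^sup>* = F\<^sup>*"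
    using uforest_swap[OF uf uw a ab b] by (auto simp: F'_def)
  have F'A: "F' \<subseteq> A" using FA abA A_sym by (auto simp: F'_def)
  have fin: "finite (F `` {x})" for x using finite_Image[OF FA] .
  have other: "F' `` {x} \<subseteq> F `` {x}" if "x \<notin> {a, b}" for x
    using that by (auto simp: F'_def)
  have ab_ne: "a \<noteq> b" using abA irrefl_A by auto
  have degab: "card (F' `` {x}) \<le> k" if "x \<in> {a, b}" for x
  proof -
    have "F' `` {x} \<subseteq> insert (if x = a then b else a) (F `` {x})"
      using that ab_ne by (auto simp: F'_def)
    then have "card (F' `` {x}) \<le> card (insert (if x = a then b else a) (F `` {x}))"
      using fin by (intro card_mono) auto
    also have "\<dots> \<le> Suc (card (F `` {x}))" using fin by (simp add: card_insert_if)
    finally show ?thesis using nD that by (auto simp: D)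
  qed
  have deg': "card (F' `` {x}) \<le> k" for x
    using degab[of x] card_mono[OF fin other, of x] deg[of x] by (cases "x \<in> {a, b}") auto
  have uD: "u \<notin> {a, b}" using nD True by (auto simp: D)
  have "F' `` {u} \<subseteq> F `` {u} - {w}" using uD side_not_base[OF uf uw] side_self[of w F u]
    by (auto simp: F'_def)
  then have "card (F' `` {u}) \<le> card (F `` {u} - {w})" using fin by (intro card_mono) auto
  also have "\<dots> < card (F `` {u})" using fin uw by (intro psubset_card_mono) auto
  finally have degu: "card (F' `` {u}) < k" using deg[of u] by simp
  have wa: "(u, a) \<in> F\<^sup>*" using converse_rtrancl_into_rtrancl[OF uw side_connected[OF a]] .
  have conn: "(u, w) \<in> F\<^sup>*" "(u, a) \<in> F\<^sup>*" "(u, b) \<in> F\<^sup>*" "(u, u) \<in> F\<^sup>*"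
    using uw wa rtrancl_trans[OF wa ab] by auto
  have same: "F' `` {x} = F `` {x}" if "(u, x) \<notin> F\<^sup>*" for x
  proof -
    have "x \<notin> {u, w, a, b}" using that conn by auto
    then show ?thesis by (auto simp: F'_def)
  qed
  have "card ((F' - F) \<union> (F - F')) \<le> card {(u, w), (w, u), (a, b), (b, a)}"
    by (intro card_mono) (auto simp: F'_def)
  also have "\<dots> \<le> 4" using card_length[of "[(u, w), (w, u), (a, b), (b, a)]"] by simp
  finally have diff: "card ((F' - F) \<union> (F - F')) \<le> 4" .
  have finD: "finite D" using finite_saturated[OF FA, of k] k by (simp add: D)
  have "{x. k \<le> card (F' `` {x})} \<subseteq> D \<union> {a, b}"
  proof
    fix x assume "x \<in> {x. k \<le> card (F' `` {x})}"
    then show "x \<in> D \<union> {a, b}" using card_mono[OF fin other, of x]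
      by (cases "x \<in> {a, b}") (auto simp: D)
  qed
  then have "card {x. k \<le> card (F' `` {x})} \<le> card (D \<union> {a, b})" using finD by (intro card_mono) auto
  also have "\<dots> \<le> card D + card {a, b}" by (rule card_Un_le)
  also have "\<dots> \<le> card D + 2" using card_length[of "[a, b]"] by simp
  finally have "card {x. k \<le> card (F' `` {x})} \<le> card D + 2" .
  then show ?thesis using swap F'A deg' degu same diff by (intro exI[of _ F']) (auto simp: tame_forest_def)
qed

lemma join_unsaturated:
  assumes F: "tame_forest k F" and xy: "(x, y) \<in> A" "(x, y) \<notin> F\<^sup>*"
    and unsat: "card (F `` {x}) < k" "card (F `` {y}) < k"
  defines "F' \<equiv> F \<union> {(x, y), (y, x)}"
  shows "tame_forest k F'" and "F\<^sup>* \<subseteq> F'\<^sup>*" and "(x, y) \<in> F'\<^sup>*"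
    and "card ((F' - F) \<union> (F - F')) \<le> 2"
proof -
  have uf: "uforest F" and FA: "F \<subseteq> A" and deg: "\<And>x. card (F `` {x}) \<le> k"
    using F by (auto simp: tame_forest_def)
  have ne: "x \<noteq> y" using xy irrefl_A by auto
  have "card (F' `` {z}) \<le> k" for z
  proof (cases "z \<in> {x, y}")
    case True
    have "F' `` {z} = insert (if z = x then y else x) (F `` {z})"
      using True ne by (auto simp: F'_def)
    then have "card (F' `` {z}) \<le> Suc (card (F `` {z}))"
      using finite_Image[OF FA] by (simp add: card_insert_if)
    then show ?thesis using True unsat by auto
  next
    case False
    then have "F' `` {z} = F `` {z}" by (auto simp: F'_def)
    then show ?thesis using deg by simp
  qed
  then show "tame_forest k F'"
    using uforest_insert[OF uf xy(2)] FA xy(1) A_sym[OF xy(1)] by (auto simp: F'_def tame_forest_def)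
  show "F\<^sup>* \<subseteq> F'\<^sup>*" by (rule rtrancl_mono) (auto simp: F'_def)
  show "(x, y) \<in> F'\<^sup>*" by (auto simp: F'_def)
  have "card ((F' - F) \<union> (F - F')) \<le> card {(x, y), (y, x)}"
    by (intro card_mono) (auto simp: F'_def)
  also have "\<dots> \<le> 2" using card_length[of "[(x, y), (y, x)]"] by simp
  finally show "card ((F' - F) \<union> (F - F')) \<le> 2" .
qed

lemma symdiff_triangle:
  assumes "F \<subseteq> A" "G \<subseteq> A" "H \<subseteq> A"
  shows "card ((H - F) \<union> (F - H)) \<le> card ((H - G) \<union> (G - H)) + card ((G - F) \<union> (F - G))"
proof -
  have "(H - F) \<union> (F - H) \<subseteq> ((H - G) \<union> (G - H)) \<union> ((G - F) \<union> (F - G))" by auto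
  then have "card ((H - F) \<union> (F - H)) \<le> card (((H - G) \<union> (G - H)) \<union> ((G - F) \<union> (F - G)))"
    using assms finite_sub by (intro card_mono) auto
  also have "\<dots> \<le> card ((H - G) \<union> (G - H)) + card ((G - F) \<union> (F - G))" by (rule card_Un_le)
  finally show ?thesis .
qed

text \<open>Both ends of a host edge between two components are relieved and then joined. If at some
  stage another host edge links unsaturated vertices of different components, it is taken at once;
  otherwise \<open>relieve\<close> applies. The cost is at most 4 + 4 + 2 arcs. The first relief may
  create two saturated vertices, hence the + 2 in \<open>M\<close>.\<close>

lemma merge_components:
  assumes F: "tame_forest k F" and k: "k \<ge> 2"
    and M: "card {x. k \<le> card (F `` {x})} + 2 \<le> M"
    and \<delta>: "\<And>v. v \<in> V \<Longrightarrow> \<delta> \<le> card (A `` {v})" "card V < k * (\<delta> - M)"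
    and uv: "(u, v) \<in> A" "(u, v) \<notin> F\<^sup>*"
  shows "\<exists>F' x y. tame_forest k F' \<and> F\<^sup>* \<subseteq> F'\<^sup>* \<and> (x, y) \<in> A \<and> (x, y) \<in> F'\<^sup>* \<and> (x, y) \<notin> F\<^sup>* \<and>
    card ((F' - F) \<union> (F - F')) \<le> 10"
proof -
  define sat where "sat F = {x. k \<le> card (F `` {x})}" for F :: "('a \<times> 'a) set"
  have sub: "F \<subseteq> A" if "tame_forest k F" for F using that by (simp add: tame_forest_def)
  have join: ?thesis if F1: "tame_forest k F1" and "F1\<^sup>* = F\<^sup>*"
    and "card ((F1 - F) \<union> (F - F1)) \<le> 8"
    and "(x, y) \<in> A" "(x, y) \<notin> F1\<^sup>*" "x \<notin> sat F1" "y \<notin> sat F1" for F1 x y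
  proof -
    let ?F = "F1 \<union> {(x, y), (y, x)}"
    have lt: "card (F1 `` {x}) < k" "card (F1 `` {y}) < k" using that by (auto simp: sat_def)
    note j = join_unsaturated[OF F1 that(4,5) lt]
    have "card ((?F - F) \<union> (F - ?F)) \<le> 2 + 8"
      using symdiff_triangle[OF sub[OF F] sub[OF F1] sub[OF j(1)]] j(4) that(3) by simp
    then show ?thesis using j that by (intro exI[of _ ?F] exI[of _ x] exI[of _ y]) auto
  qed
  show ?thesis
  proof (cases "\<forall>x y. (x, y) \<in> A \<longrightarrow> x \<notin> sat F \<longrightarrow> y \<notin> sat F \<longrightarrow> (x, y) \<in> F\<^sup>*")
    case False
    then show ?thesis using join[OF F] by auto
  next
    case True
    then obtain F1 where F1: "tame_forest k F1" "F1\<^sup>* = F\<^sup>*" "card (F1 `` {u}) < k"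
      "card ((F1 - F) \<union> (F - F1)) \<le> 4" "card (sat F1) \<le> card (sat F) + 2"
      using relieve[OF F k sat_def _ _ \<delta>, of u] M unfolding sat_def by auto
    have M1: "card (sat F1) \<le> M" using F1(5) M by (simp add: sat_def)
    show ?thesis
    proof (cases "\<forall>x y. (x, y) \<in> A \<longrightarrow> x \<notin> sat F1 \<longrightarrow> y \<notin> sat F1 \<longrightarrow> (x, y) \<in> F1\<^sup>*")
      case False
      then show ?thesis using join[OF F1(1,2)] F1(4) by auto
    next
      case True
      then obtain F2 where F2: "tame_forest k F2" "F2\<^sup>* = F1\<^sup>*" "card (F2 `` {v}) < k"
        "\<forall>x. (v, x) \<notin> F1\<^sup>* \<longrightarrow> F2 `` {x} = F1 `` {x}" "card ((F2 - F1) \<union> (F1 - F2)) \<le> 4"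
        using relieve[OF F1(1) k sat_def M1 _ \<delta>, of v] by auto
      have "sym F" using F by (simp add: tame_forest_def uforest_def)
      then have "(v, u) \<notin> F1\<^sup>*" using uv(2) F1(2) rtrancl_symD by metis
      \<comment> \<open>u is not in the component of v, so relieving v leaves the degree of u as it
        was.\<close>
      then have "card (F2 `` {u}) < k" using F2(4) F1(3) by auto
      moreover have "card ((F2 - F) \<union> (F - F2)) \<le> 4 + 4"
        using symdiff_triangle[OF sub[OF F] sub[OF F1(1)] sub[OF F2(1)]] F1(4) F2(5) by simp
      ultimately show ?thesis using join[OF F2(1), of u v] F1 F2 uv by (auto simp: sat_def)
    qed
  qed
qed

lemma connect_forest:
  assumes F0: "uforest F0" "F0 \<subseteq> A" "\<And>x. card (F0 `` {x}) < k" and k: "k \<ge> 2"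
    and R: "R \<subseteq> V" "V \<subseteq> F0\<^sup>* `` R" "card R \<le> c"
    and \<delta>: "\<And>v. v \<in> V \<Longrightarrow> \<delta> \<le> card (A `` {v})" "card V < k * (\<delta> - (10 * c + 2))"
    and conn: "\<And>u v. u \<in> V \<Longrightarrow> v \<in> V \<Longrightarrow> (u, v) \<in> A\<^sup>*"
  shows "\<exists>F. tame_forest k F \<and> (\<forall>u\<in>V. \<forall>v\<in>V. (u, v) \<in> F\<^sup>*) \<and> card ((F - F0) \<union> (F0 - F)) \<le> 10 * c"
proof -
  have main: "\<exists>F. tame_forest k F \<and> (\<forall>u\<in>V. \<forall>v\<in>V. (u, v) \<in> F\<^sup>*) \<and> card ((F - F0) \<union> (F0 - F)) \<le> 10 * c"
    if "tame_forest k F" "R \<subseteq> V" "V \<subseteq> F\<^sup>* `` R" "card ((F - F0) \<union> (F0 - F)) + 10 * card R \<le> 10 * c"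
    for F R
    using that
  proof (induction "card R" arbitrary: F R)
    case 0
    then have "R = {}" using finite_subset[OF 0(3) finite_V] by simp
    then have "V = {}" using 0 by auto
    then show ?case using 0 by (intro exI[of _ F]) auto
  next
    case (Suc m)
    have finR: "finite R" using Suc.prems(2) finite_V finite_subset by blast
    have FA: "F \<subseteq> A" and symF: "sym F" using Suc.prems(1) by (auto simp: tame_forest_def uforest_def)
    show ?case
    proof (cases "\<forall>u\<in>V. \<forall>v\<in>V. (u, v) \<in> F\<^sup>*")
      case True
      then show ?thesis using Suc.prems by (intro exI[of _ F]) auto
    next
      case False
      then obtain u v where uv: "(u, v) \<in> A" "(u, v) \<notin> F\<^sup>*"
      proof -
        have "\<not> A \<subseteq> F\<^sup>*"
        proof
          assume "A \<subseteq> F\<^sup>*"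
          then have "A\<^sup>* \<subseteq> F\<^sup>*" by (metis rtrancl_mono rtrancl_idemp)
          then show False using False conn by blast
        qed
        then show ?thesis using that by auto
      qed
      \<comment> \<open>All degrees in \<open>F0\<close> are below \<open>k\<close>, so a saturated
        vertex is an end of an arc added since. This bounds the saturated vertices by the number of
        changes.\<close>
      have "{x. k \<le> card (F `` {x})} \<subseteq> fst ` (F - F0)"
      proof
        fix x assume "x \<in> {x. k \<le> card (F `` {x})}"
        then have "\<not> F `` {x} \<subseteq> F0 `` {x}"
          using card_mono[OF finite_Image[OF F0(2)], of "F `` {x}" "{x}"] F0(3)[of x] by fastforce
        then show "x \<in> fst ` (F - F0)" by force
      qed
      then have "card {x. k \<le> card (F `` {x})} \<le> card (fst ` (F - F0))"
        using finite_sub[OF FA] by (intro card_mono) auto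
      also have "\<dots> \<le> card (F - F0)" using finite_sub[OF FA] by (intro card_image_le) auto
      also have "\<dots> \<le> card ((F - F0) \<union> (F0 - F))"
        using finite_sub[OF FA] finite_sub[OF F0(2)] by (intro card_mono) auto
      finally have M: "card {x. k \<le> card (F `` {x})} + 2 \<le> 10 * c + 2" using Suc.prems(4) by simp
      obtain F' x y where F': "tame_forest k F'" "F\<^sup>* \<subseteq> F'\<^sup>*" "(x, y) \<in> A" "(x, y) \<in> F'\<^sup>*"
        "(x, y) \<notin> F\<^sup>*" "card ((F' - F) \<union> (F - F')) \<le> 10"
        using merge_components[OF Suc.prems(1) k M \<delta> uv] by blast
      have F'A: "F' \<subseteq> A" and symF': "sym F'" using F'(1) by (auto simp: tame_forest_def uforest_def)
      obtain r s where rs: "r \<in> R" "s \<in> R" "(r, x) \<in> F\<^sup>*" "(s, y) \<in> F\<^sup>*"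
        using Suc.prems(3) A_V[OF F'(3)] by blast
      have ne: "r \<noteq> s" using rs F'(5) by (meson rtrancl_symD[OF symF] rtrancl_trans)
      have rs': "(r, s) \<in> F'\<^sup>*"
        using rs F'(2,4) by (meson rtrancl_symD[OF symF'] rtrancl_trans subsetD)
      have cR: "card (R - {s}) = m" using Suc.hyps(2) rs finR by simp
      have "V \<subseteq> F'\<^sup>* `` (R - {s})"
      proof
        fix z assume "z \<in> V"
        then obtain t where t: "t \<in> R" "(t, z) \<in> F\<^sup>*" using Suc.prems(3) by blast
        then have "(t, z) \<in> F'\<^sup>*" using F'(2) by blast
        then show "z \<in> F'\<^sup>* `` (R - {s})"
          using t rs rs' ne by (cases "t = s") (auto intro: rtrancl_trans)
      qed
      moreover have "card ((F' - F0) \<union> (F0 - F')) + 10 * card (R - {s}) \<le> 10 * c"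
        using symdiff_triangle[OF F0(2) FA F'A] F'(6) Suc.prems(4) Suc.hyps(2)[symmetric] cR by simp
      moreover have "R - {s} \<subseteq> V" using Suc.prems(2) by auto
      ultimately show ?thesis using Suc.hyps(1)[OF cR[symmetric] F'(1)] by blast
    qed
  qed
  have "tame_forest k F0" using F0 by (auto simp: tame_forest_def intro: less_imp_le)
  then show ?thesis using main[of F0 R] R by simp
qed

end


section \<open>Extending rooted forests\<close>

text \<open>A spanning forest of rooted trees is encoded by its arcs from children to parents.\<close>

context host_graph
begin

definition in_forest :: "nat \<Rightarrow> ('a \<times> 'a) set \<Rightarrow> bool" where
  "in_forest h E \<longleftrightarrow> E \<subseteq> A \<and> single_valued E \<and> acyclic E \<and> (\<forall>u. card (E\<inverse> `` {u}) \<le> h)"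

definition roots :: "('a \<times> 'a) set \<Rightarrow> 'a set" where
  "roots E = V - Domain E"

definition saturated :: "nat \<Rightarrow> ('a \<times> 'a) set \<Rightarrow> 'a set" where
  "saturated h E = {u \<in> V. h \<le> card (E\<inverse> `` {u})}"

text \<open>Bounds the number of selections that contain a given forest: only the values at the
  roots are still free, see \<open>card_selections_le_weight\<close>.\<close>

definition weight :: "('a \<times> 'a) set \<Rightarrow> real" where
  "weight E = (\<Prod>v\<in>roots E. real (card (A `` {v})))"

definition extensions :: "nat \<Rightarrow> nat \<Rightarrow> ('a \<times> 'a) set \<Rightarrow> ('a \<times> 'a) set set" where
  "extensions h c E = {E'. E \<subseteq> E' \<and> in_forest h E' \<and> card (roots E') \<le> c}"

lemma finite_roots: "finite (roots E)"
  by (simp add: roots_def finite_V)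

lemma weight_nonneg: "0 \<le> weight E"
  by (simp add: weight_def prod_nonneg)

lemma finite_extensions: "finite (extensions h c E)"
  by (rule finite_subset[of _ "Pow A"]) (auto simp: extensions_def in_forest_def finite_A)

text \<open>Trees of distinct roots are disjoint, and more than \<open>c\<close> of them, each
  larger than \<open>card V div c\<close>, do not fit into \<open>V\<close>.\<close>

lemma small_tree:
  assumes E: "in_forest h E" and c: "c < card (roots E)" "c > 0"
  shows "\<exists>v\<in>roots E. card {x. (x, v) \<in> E\<^sup>*} \<le> card V div c"
proof (rule ccontr)
  assume "\<not> ?thesis"
  then have big: "card V div c < card {x. (x, v) \<in> E\<^sup>*}" if "v \<in> roots E" for v
    using that by (simp add: not_le)
  have sv: "single_valued E" and EA: "E \<subseteq> A" using E by (auto simp: in_forest_def)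
  have sub: "{x. (x, v) \<in> E\<^sup>*} \<subseteq> V" if "v \<in> roots E" for v
  proof
    fix x assume "x \<in> {x. (x, v) \<in> E\<^sup>*}"
    then have "(x, v) \<in> E\<^sup>*" by simp
    then show "x \<in> V" using that EA A_V by (cases rule: converse_rtranclE) (auto simp: roots_def)
  qed
  have eq: "v = w" if "v \<in> roots E" "w \<in> roots E" "(x, v) \<in> E\<^sup>*" "(x, w) \<in> E\<^sup>*" for v w x
  proof -
    have root: "y = x" if "(x, y) \<in> E\<^sup>*" "x \<in> roots E" for x y
      using that by (cases rule: converse_rtranclE) (auto simp: roots_def)
    show ?thesis using single_valued_confluent[OF sv that(3,4)] root that(1,2) by metis
  qed
  have "card V < c * Suc (card V div c)"
    using c(2) by (metis dividend_less_times_div mult_Suc_right)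
  also have "\<dots> \<le> card (roots E) * Suc (card V div c)" using c(1) by (intro mult_right_mono) auto
  also have "\<dots> = (\<Sum>v\<in>roots E. Suc (card V div c))" by simp
  also have "\<dots> \<le> (\<Sum>v\<in>roots E. card {x. (x, v) \<in> E\<^sup>*})" using big by (intro sum_mono) (simp add: Suc_leI)
  also have "\<dots> = card (\<Union>v\<in>roots E. {x. (x, v) \<in> E\<^sup>*})"
  proof (intro card_UN_disjoint[symmetric] ballI impI)
    show "finite (roots E)" by (rule finite_roots)
    show "finite {x. (x, v) \<in> E\<^sup>*}" if "v \<in> roots E" for v
      using sub[OF that] finite_V by (rule finite_subset)
    show "{x. (x, v) \<in> E\<^sup>*} \<inter> {x. (x, w) \<in> E\<^sup>*} = {}"
      if "v \<in> roots E" "w \<in> roots E" "v \<noteq> w" for v w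
      using eq[OF that(1,2)] that(3) by auto
  qed
  also have "\<dots> \<le> card V" using sub finite_V by (intro card_mono) auto
  finally show False by simp
qed

text \<open>One root disappears and at most one vertex becomes saturated, so the sum of the two
  cardinalities never grows. This makes the bound \<open>b\<close> in
  \<open>weight_extensions\<close> an invariant.\<close>

lemma in_forest_insert:
  assumes E: "in_forest h E" and v: "v \<in> roots E" and vw: "(v, w) \<in> A"
    and w: "w \<notin> saturated h E" "(w, v) \<notin> E\<^sup>*"
  shows "in_forest h (insert (v, w) E)"
    and "roots (insert (v, w) E) = roots E - {v}"
    and "saturated h (insert (v, w) E) \<subseteq> insert w (saturated h E)"
proof -
  have vD: "v \<notin> Domain E" using v by (auto simp: roots_def)
  have conv: "(insert (v, w) E)\<inverse> `` {u} = (if u = w then insert v (E\<inverse> `` {u}) else E\<inverse> `` {u})" for u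
    by auto
  have fin: "finite (E\<inverse> `` {u})" for u
  proof (rule finite_subset[OF _ finite_V])
    show "E\<inverse> `` {u} \<subseteq> V" using E A_V by (auto simp: in_forest_def)
  qed
  have "w \<in> V" using vw A_V by auto
  then have "card (E\<inverse> `` {w}) < h" using w(1) by (auto simp: saturated_def)
  then have "card ((insert (v, w) E)\<inverse> `` {u}) \<le> h" for u
    using E fin by (auto simp: conv in_forest_def card_insert_if)
  moreover have "single_valued (insert (v, w) E)"
    using E vD by (auto simp: in_forest_def single_valued_def)
  ultimately show "in_forest h (insert (v, w) E)"
    using E vw w(2) by (simp add: in_forest_def)
  show "roots (insert (v, w) E) = roots E - {v}" by (auto simp: roots_def)
  show "saturated h (insert (v, w) E) \<subseteq> insert w (saturated h E)"
    by (auto simp: saturated_def conv split: if_splits)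
qed

text \<open>Attaching the root of a smallest tree to an unsaturated vertex outside its tree leaves at
  least half of its neighbours to choose from, and later choices determine earlier ones.\<close>

lemma weight_extensions:
  assumes E: "in_forest h E" and c: "c > 0"
    and b: "card (saturated h E) + card (roots E) \<le> b"
    and d: "\<And>v. v \<in> V \<Longrightarrow> 2 * (b + card V div c) \<le> card (A `` {v})"
  shows "weight E / 2 ^ card (roots E) \<le> sum weight (extensions h c E)"
  using E b
proof (induction "card (roots E)" arbitrary: E rule: less_induct)
  case less
  show ?case
  proof (cases "card (roots E) \<le> c")
    case True
    then have "E \<in> extensions h c E" using less.prems by (simp add: extensions_def)
    then have "weight E \<le> sum weight (extensions h c E)"
      using finite_extensions weight_nonneg by (intro member_le_sum) auto
    moreover have "weight E / 2 ^ card (roots E) \<le> weight E"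
      using weight_nonneg[of E] by (simp add: divide_le_eq mult_le_cancel_left1)
    ultimately show ?thesis by simp
  next
    case False
    then obtain v where v: "v \<in> roots E" "card {x. (x, v) \<in> E\<^sup>*} \<le> card V div c"
      using small_tree[OF less.prems(1) _ c] by auto
    define W where "W = A `` {v} - ({x. (x, v) \<in> E\<^sup>*} \<union> saturated h E)"
    have EA: "E \<subseteq> A" using less.prems by (simp add: in_forest_def)
    have vV: "v \<in> V" using v by (simp add: roots_def)
    have finN: "finite (A `` {v})" using finite_Image by blast
    have finT: "finite {x. (x, v) \<in> E\<^sup>*}"
    proof -
      have "{x. (x, v) \<in> E\<^sup>*} \<subseteq> V"
      proof
        fix x assume "x \<in> {x. (x, v) \<in> E\<^sup>*}"
        then have "(x, v) \<in> E\<^sup>*" by simp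
        then show "x \<in> V" using vV EA A_V by (cases rule: converse_rtranclE) auto
      qed
      then show ?thesis using finite_V finite_subset by blast
    qed
    have finS: "finite (saturated h E)" by (simp add: saturated_def finite_V)
    have "card (A `` {v}) - card ({x. (x, v) \<in> E\<^sup>*} \<union> saturated h E) \<le> card W"
      unfolding W_def using finT finS by (intro diff_card_le_card_Diff) auto
    moreover have "card ({x. (x, v) \<in> E\<^sup>*} \<union> saturated h E) \<le> card V div c + b"
      using card_Un_le[of "{x. (x, v) \<in> E\<^sup>*}" "saturated h E"] v(2) less.prems(2) by linarith
    moreover have "a \<le> 2 * w" if "a - u \<le> w" "u \<le> q + b" "2 * (b + q) \<le> a" for a u w q :: nat
      using that by arith
    \<comment> \<open>At most \<open>b + card V div c\<close> neighbours are excluded, which by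
      \<open>d\<close> is no more than half of them.\<close>
    ultimately have W: "card (A `` {v}) \<le> 2 * card W" using d[OF vV] by blast
    define r where "r = card (roots E) - 1"
    have r: "card (roots E) = Suc r" using False by (simp add: r_def)
    have step: "weight E / card (A `` {v}) / 2 ^ r \<le> sum weight (extensions h c (insert (v, w) E))"
      if w: "w \<in> W" for w
    proof -
      have vw: "(v, w) \<in> A" "w \<notin> saturated h E" "(w, v) \<notin> E\<^sup>*" using w by (auto simp: W_def)
      note ins = in_forest_insert[OF less.prems(1) v(1) vw]
      have cr: "card (roots (insert (v, w) E)) = r"
        using ins(2) v(1) r finite_roots by simp
      have "card (saturated h (insert (v, w) E)) \<le> card (insert w (saturated h E))"
        using finS ins(3) by (intro card_mono) auto
      also have "\<dots> \<le> Suc (card (saturated h E))" using finS by (simp add: card_insert_if)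
      finally have "card (saturated h (insert (v, w) E)) + card (roots (insert (v, w) E)) \<le> b"
        using less.prems(2) r cr by simp
      from less.hyps[OF _ ins(1) this]
      have "weight (insert (v, w) E) / 2 ^ r \<le> sum weight (extensions h c (insert (v, w) E))"
        using cr r by simp
      moreover have "weight E = card (A `` {v}) * weight (insert (v, w) E)"
        unfolding weight_def ins(2) using v(1) finite_roots by (simp add: prod.remove)
      moreover have "card (A `` {v}) > 0" using vw finN by (auto simp: card_gt_0_iff)
      ultimately show ?thesis by simp
    qed
    show ?thesis
    proof (cases "card (A `` {v}) = 0")
      case True
      then have "weight E = 0" using v(1) finite_roots by (auto simp: weight_def prod_zero_iff)
      then show ?thesis using weight_nonneg by (simp add: sum_nonneg)
    next
      case False
      \<comment> \<open>The degree of v leaves the weight together with the root v. Half of it is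
        regained as the number \<open>card W\<close> of choices; the other half is the factor 2
        charged per root.\<close>
      have "weight E / 2 ^ card (roots E) = card (A `` {v}) / 2 * (weight E / card (A `` {v}) / 2 ^ r)"
        using False r by simp
      also have "\<dots> \<le> card W * (weight E / card (A `` {v}) / 2 ^ r)"
        using W weight_nonneg[of E] by (intro mult_right_mono) auto
      also have "\<dots> = (\<Sum>w\<in>W. weight E / card (A `` {v}) / 2 ^ r)" by simp
      also have "\<dots> \<le> (\<Sum>w\<in>W. sum weight (extensions h c (insert (v, w) E)))"
        by (intro sum_mono step)
      also have "\<dots> = sum weight (\<Union>w\<in>W. extensions h c (insert (v, w) E))"
      proof (intro sum.UNION_disjoint[symmetric] ballI impI)
        show "finite W" using finN by (simp add: W_def)
        show "finite (extensions h c (insert (v, w) E))" for w by (rule finite_extensions)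
        show "extensions h c (insert (v, w) E) \<inter> extensions h c (insert (v, w') E) = {}"
          if "w \<noteq> w'" for w w'
        proof (rule ccontr)
          assume "\<not> ?thesis"
          then obtain E' where "single_valued E'" "(v, w) \<in> E'" "(v, w') \<in> E'"
            by (auto simp: extensions_def in_forest_def)
          then show False using that by (auto dest: single_valuedD)
        qed
      qed
      also have "\<dots> \<le> sum weight (extensions h c E)"
      proof (rule sum_mono2)
        show "(\<Union>w\<in>W. extensions h c (insert (v, w) E)) \<subseteq> extensions h c E"
          by (auto simp: extensions_def)
      qed (rule finite_extensions weight_nonneg)+
      finally show ?thesis .
    qed
  qed
qed

lemma card_selections_le_weight:
  "real (card {f \<in> PiE V (\<lambda>v. A `` {v}). \<forall>(v, w)\<in>E. f v = w}) \<le> weight E"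
proof -
  let ?P = "{f \<in> PiE V (\<lambda>v. A `` {v}). \<forall>(v, w)\<in>E. f v = w}"
  have "inj_on (\<lambda>f. restrict f (roots E)) ?P"
  proof (rule inj_onI)
    fix f g assume f: "f \<in> ?P" and g: "g \<in> ?P" and eq: "restrict f (roots E) = restrict g (roots E)"
    show "f = g"
    proof (rule PiE_ext)
      show "f \<in> PiE V (\<lambda>v. A `` {v})" "g \<in> PiE V (\<lambda>v. A `` {v})" using f g by auto
      fix v assume v: "v \<in> V"
      show "f v = g v"
      proof (cases "v \<in> roots E")
        case True
        then show ?thesis using fun_cong[OF eq, of v] by simp
      next
        case False
        then obtain w where "(v, w) \<in> E" using v by (auto simp: roots_def)
        then show ?thesis using f g by auto
      qed
    qed
  qed
  moreover have "(\<lambda>f. restrict f (roots E)) ` ?P \<subseteq> PiE (roots E) (\<lambda>v. A `` {v})"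
  proof (rule image_subsetI)
    fix f assume "f \<in> ?P"
    then have "\<forall>v\<in>roots E. f v \<in> A `` {v}" by (auto simp: roots_def PiE_iff)
    then show "restrict f (roots E) \<in> PiE (roots E) (\<lambda>v. A `` {v})" unfolding restrict_PiE_iff .
  qed
  moreover have "finite (PiE (roots E) (\<lambda>v. A `` {v}))"
    using finite_roots finite_Image by (intro finite_PiE) auto
  ultimately have "card ?P \<le> card (PiE (roots E) (\<lambda>v. A `` {v}))" by (rule card_inj_on_le)
  also have "real \<dots> = weight E" by (simp add: weight_def card_PiE[OF finite_roots])
  finally show ?thesis by simp
qed

lemma weight_le:
  assumes "card (roots E) \<le> c" "V \<noteq> {}"
  shows "weight E \<le> real (card V) ^ c"
proof -
  have "card (A `` {v}) \<le> card V" for v using A_V finite_V by (intro card_mono) auto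
  then have "weight E \<le> (\<Prod>v\<in>roots E. real (card V))"
    unfolding weight_def by (intro prod_mono) auto
  also have "\<dots> \<le> real (card V) ^ c"
    using assms finite_V by (auto simp: card_gt_0_iff Suc_le_eq intro!: power_increasing)
  finally show ?thesis .
qed

text \<open>Double counting of pairs of a pruned forest E and an extension E'. The weight of E pays
  for the selections pruned to E and passes to its extensions at a cost of at most
  \<open>2 ^ m\<close>. Each E' is hit by at most as many E as there are root sets of size at most
  \<open>m\<close>, and its own weight is at most \<open>card V\<close> to the power
  \<open>c\<close>.\<close>

lemma selections_le_forests:
  assumes \<Phi>: "\<Phi> \<subseteq> PiE V (\<lambda>v. A `` {v})" and V: "V \<noteq> {}" and c: "c > 0"
    and prune: "\<And>f. f \<in> \<Phi> \<Longrightarrow> \<exists>E. in_forest h E \<and> (\<forall>(v, w)\<in>E. f v = w) \<and>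
      card (roots E) \<le> m \<and> card (saturated h E) + card (roots E) \<le> b"
    and d: "\<And>v. v \<in> V \<Longrightarrow> 2 * (b + card V div c) \<le> card (A `` {v})"
  shows "real (card \<Phi>) \<le> 2 ^ m * real (card {S. S \<subseteq> V \<and> card S \<le> m}) * real (card V) ^ c *
    real (card {E. in_forest h E \<and> card (roots E) \<le> c})"
proof -
  obtain \<epsilon> where \<epsilon>: "\<And>f. f \<in> \<Phi> \<Longrightarrow> in_forest h (\<epsilon> f) \<and> (\<forall>(v, w)\<in>\<epsilon> f. f v = w) \<and>
      card (roots (\<epsilon> f)) \<le> m \<and> card (saturated h (\<epsilon> f)) + card (roots (\<epsilon> f)) \<le> b"
    using prune by metis
  define Q where "Q = {E. in_forest h E \<and> card (roots E) \<le> c}"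
  have finP: "finite (PiE V (\<lambda>v. A `` {v}))" using finite_V finite_Image by (intro finite_PiE) auto
  then have fin\<Phi>: "finite \<Phi>" using \<Phi> finite_subset by blast
  have finQ: "finite Q"
    by (rule finite_subset[of _ "Pow A"]) (auto simp: Q_def in_forest_def finite_A)
  have "\<Phi> = (\<Union>E\<in>\<epsilon> ` \<Phi>. {f \<in> \<Phi>. \<epsilon> f = E})" by auto
  then have "real (card \<Phi>) = real (card (\<Union>E\<in>\<epsilon> ` \<Phi>. {f \<in> \<Phi>. \<epsilon> f = E}))" by simp
  also have "\<dots> \<le> real (\<Sum>E\<in>\<epsilon> ` \<Phi>. card {f \<in> \<Phi>. \<epsilon> f = E})"
    using fin\<Phi> by (intro of_nat_mono card_UN_le) auto
  also have "\<dots> \<le> (\<Sum>E\<in>\<epsilon> ` \<Phi>. weight E)"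
    unfolding of_nat_sum
  proof (rule sum_mono)
    fix E assume "E \<in> \<epsilon> ` \<Phi>"
    have "{f \<in> \<Phi>. \<epsilon> f = E} \<subseteq> {f \<in> PiE V (\<lambda>v. A `` {v}). \<forall>(v, w)\<in>E. f v = w}"
    proof
      fix f assume "f \<in> {f \<in> \<Phi>. \<epsilon> f = E}"
      then show "f \<in> {f \<in> PiE V (\<lambda>v. A `` {v}). \<forall>(v, w)\<in>E. f v = w}"
        using \<Phi> \<epsilon>[of f] by auto
    qed
    then have "card {f \<in> \<Phi>. \<epsilon> f = E} \<le> card {f \<in> PiE V (\<lambda>v. A `` {v}). \<forall>(v, w)\<in>E. f v = w}"
      using finP by (intro card_mono) auto
    then show "real (card {f \<in> \<Phi>. \<epsilon> f = E}) \<le> weight E" using card_selections_le_weight[of E] by linarith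
  qed
  also have "\<dots> \<le> (\<Sum>E\<in>\<epsilon> ` \<Phi>. 2 ^ m * sum weight (extensions h c E))"
  proof (rule sum_mono)
    fix E assume "E \<in> \<epsilon> ` \<Phi>"
    then have E: "in_forest h E" "card (roots E) \<le> m" "card (saturated h E) + card (roots E) \<le> b"
      using \<epsilon> by auto
    have "weight E \<le> 2 ^ card (roots E) * sum weight (extensions h c E)"
      using weight_extensions[OF E(1) c E(3) d] by (simp add: field_simps)
    also have "\<dots> \<le> 2 ^ m * sum weight (extensions h c E)"
      using E(2) weight_nonneg by (intro mult_right_mono sum_nonneg power_increasing) auto
    finally show "weight E \<le> 2 ^ m * sum weight (extensions h c E)" .
  qed
  also have "\<dots> = 2 ^ m * (\<Sum>E\<in>\<epsilon> ` \<Phi>. \<Sum>E'\<in>{E'\<in>Q. E \<subseteq> E'}. weight E')"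
  proof -
    have "extensions h c E = {E'\<in>Q. E \<subseteq> E'}" for E by (auto simp: extensions_def Q_def)
    then show ?thesis by (simp only: sum_distrib_left)
  qed
  also have "(\<Sum>E\<in>\<epsilon> ` \<Phi>. \<Sum>E'\<in>{E'\<in>Q. E \<subseteq> E'}. weight E') =
      (\<Sum>E'\<in>Q. \<Sum>E\<in>{E\<in>\<epsilon> ` \<Phi>. E \<subseteq> E'}. weight E')"
    using fin\<Phi> finQ by (intro sum.swap_restrict) auto
  also have "\<dots> \<le> (\<Sum>E'\<in>Q. real (card {S. S \<subseteq> V \<and> card S \<le> m}) * real (card V) ^ c)"
  proof (rule sum_mono)
    fix E' assume E': "E' \<in> Q"
    have sv: "single_valued E'" using E' by (simp add: Q_def in_forest_def)
    \<comment> \<open>Inside E' an arc is determined by its tail, so a subforest is determined by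
      its domain and hence by its roots.\<close>
    have "inj_on roots {E\<in>\<epsilon> ` \<Phi>. E \<subseteq> E'}"
    proof (rule inj_onI)
      fix E1 E2 assume E1: "E1 \<in> {E\<in>\<epsilon> ` \<Phi>. E \<subseteq> E'}" and E2: "E2 \<in> {E\<in>\<epsilon> ` \<Phi>. E \<subseteq> E'}"
        and eq: "roots E1 = roots E2"
      have "E1 \<subseteq> A" "E2 \<subseteq> A" using E1 E2 \<epsilon> by (auto simp: in_forest_def)
      then have "Domain E1 \<subseteq> V" "Domain E2 \<subseteq> V" using A_V by auto
      then have dom: "Domain E1 = Domain E2" using eq unfolding roots_def by blast
      have "E1 = {(x, y) \<in> E'. x \<in> Domain E1}" using E1 sv by (auto dest: single_valuedD)
      moreover have "E2 = {(x, y) \<in> E'. x \<in> Domain E2}" using E2 sv by (auto dest: single_valuedD)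
      ultimately show "E1 = E2" using dom by simp
    qed
    moreover have "roots ` {E\<in>\<epsilon> ` \<Phi>. E \<subseteq> E'} \<subseteq> {S. S \<subseteq> V \<and> card S \<le> m}"
      using \<epsilon> by (auto simp: roots_def)
    moreover have "finite {S. S \<subseteq> V \<and> card S \<le> m}" using finite_V by simp
    ultimately have "card {E\<in>\<epsilon> ` \<Phi>. E \<subseteq> E'} \<le> card {S. S \<subseteq> V \<and> card S \<le> m}"
      by (rule card_inj_on_le)
    moreover have "weight E' \<le> real (card V) ^ c" using weight_le V E' by (simp add: Q_def)
    ultimately show "(\<Sum>E\<in>{E\<in>\<epsilon> ` \<Phi>. E \<subseteq> E'}. weight E') \<le>
        real (card {S. S \<subseteq> V \<and> card S \<le> m}) * real (card V) ^ c"
      using weight_nonneg by (simp add: mult_mono)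
  qed
  finally show ?thesis by (simp add: Q_def mult_ac)
qed

end


section \<open>Random choices of neighbours\<close>

context host_graph
begin

abbreviation selections :: "('a \<Rightarrow> 'a) set" where
  "selections \<equiv> PiE V (\<lambda>v. A `` {v})"

definition in_count :: "('a \<Rightarrow> 'a) \<Rightarrow> 'a \<Rightarrow> nat" where
  "in_count f u = card {v \<in> V. f v = u}"

definition excess :: "nat \<Rightarrow> ('a \<Rightarrow> 'a) \<Rightarrow> nat" where
  "excess q f = (\<Sum>u\<in>V. in_count f u - q)"

definition short_periodic :: "nat \<Rightarrow> ('a \<Rightarrow> 'a) \<Rightarrow> 'a set" where
  "short_periodic L f = {v \<in> V. \<exists>l\<in>{1..L}. (f ^^ l) v = v}"

lemma finite_selections: "finite selections"
  using finite_V finite_Image by (intro finite_PiE) auto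

lemma card_selections: "card selections = (\<Prod>v\<in>V. card (A `` {v}))"
  by (simp add: card_PiE finite_V)

lemma selections_V: "f \<in> selections \<Longrightarrow> v \<in> V \<Longrightarrow> f v \<in> V"
  using A_V by (fastforce simp: PiE_iff)

lemma funpow_V: "f \<in> selections \<Longrightarrow> v \<in> V \<Longrightarrow> (f ^^ i) v \<in> V"
  by (induction i) (auto intro: selections_V)

text \<open>The last arc of a cycle through \<open>v\<close> of minimal period \<open>l\<close> can be redirected arbitrarily without
  losing track of where it was.\<close>

lemma card_minimal_period:
  assumes v: "v \<in> V" and l: "l \<ge> 1" and d: "\<And>u. u \<in> V \<Longrightarrow> \<delta> \<le> card (A `` {u})"
  shows "card {f \<in> selections. (f ^^ l) v = v \<and> (\<forall>i\<in>{1..<l}. (f ^^ i) v \<noteq> v)} * \<delta> \<le> card selections"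
proof -
  let ?B = "{f \<in> selections. (f ^^ l) v = v \<and> (\<forall>i\<in>{1..<l}. (f ^^ i) v \<noteq> v)}"
  define e where "e f = (f ^^ (l - 1)) v" for f :: "'a \<Rightarrow> 'a"
  let ?S = "SIGMA f:?B. A `` {e f}"
  have fe: "f (e f) = v" if "f \<in> ?B" for f
  proof -
    have "(f ^^ Suc (l - 1)) v = v" using that l by simp
    then show ?thesis by (simp add: e_def)
  qed
  have path: "((f(e f := w)) ^^ i) v = (f ^^ i) v" if "f \<in> ?B" "i \<le> l - 1" for f w i
    using that(2)
  proof (induction i)
    case (Suc i)
    \<comment> \<open>An earlier visit to \<open>e f\<close> would lead back to v after fewer than l
      steps. Hence the redirected function still traces the path, from which \<open>e f\<close> can
      be read off.\<close>
    have "(f ^^ i) v \<noteq> e f"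
    proof
      assume "(f ^^ i) v = e f"
      then have "(f ^^ Suc i) v = v" using fe[OF that(1)] by simp
      moreover have "Suc i \<in> {1..<l}" using Suc.prems l by auto
      ultimately show False using that(1) by blast
    qed
    then show ?case using Suc by simp
  qed simp
  have "inj_on (\<lambda>(f, w). f(e f := w)) ?S"
  proof (rule inj_onI, clarify)
    fix f w g x assume f: "f \<in> selections" "(f ^^ l) v = v" "\<forall>i\<in>{1..<l}. (f ^^ i) v \<noteq> v"
      and g: "g \<in> selections" "(g ^^ l) v = v" "\<forall>i\<in>{1..<l}. (g ^^ i) v \<noteq> v"
      and eq: "f(e f := w) = g(e g := x)"
    have fB: "f \<in> ?B" "g \<in> ?B" using f g by auto
    have e: "e f = e g"
      using path[OF fB(1), of "l - 1" w] path[OF fB(2), of "l - 1" x] eq by (simp add: e_def)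
    have "f = (f(e f := w))(e f := v)" using fe[OF fB(1)] by auto
    also have "\<dots> = (g(e g := x))(e g := v)" using eq e by simp
    also have "\<dots> = g" using fe[OF fB(2)] by auto
    finally have "f = g" .
    moreover have "w = x" using fun_cong[OF eq, of "e f"] e by simp
    ultimately show "f = g \<and> w = x" by simp
  qed
  moreover have "(\<lambda>(f, w). f(e f := w)) ` ?S \<subseteq> selections"
    using funpow_V v by (auto simp: e_def PiE_iff extensional_def)
  ultimately have "card ?S \<le> card selections" using finite_selections by (rule card_inj_on_le)
  moreover have "card ?S = (\<Sum>f\<in>?B. card (A `` {e f}))"
    using finite_selections finite_Image by (intro card_SigmaI) auto
  moreover have "(\<Sum>f\<in>?B. card (A `` {e f})) \<ge> (\<Sum>f\<in>?B. \<delta>)"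
    using funpow_V v d by (intro sum_mono) (auto simp: e_def)
  ultimately show ?thesis by simp
qed

text \<open>Union bound over vertices and minimal periods up to \<open>L\<close>; by
  \<open>card_minimal_period\<close> each such pair occurs in at most a fraction 1 / \<delta> of the
  selections.\<close>

lemma sum_short_periodic:
  assumes d: "\<And>u. u \<in> V \<Longrightarrow> \<delta> \<le> card (A `` {u})"
  shows "(\<Sum>f\<in>selections. card (short_periodic L f)) * \<delta> \<le> card V * L * card selections"
proof -
  define B where "B v l = {f \<in> selections. (f ^^ l) v = v \<and> (\<forall>i\<in>{1..<l}. (f ^^ i) v \<noteq> v)}" for v l
  have finB: "finite (B v l)" for v l using finite_selections by (simp add: B_def)
  have "card (short_periodic L f) \<le> (\<Sum>v\<in>V. \<Sum>l=1..L. if f \<in> B v l then 1 else 0)" if f: "f \<in> selections" for f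
  proof -
    have "card (short_periodic L f) = (\<Sum>v\<in>V. if v \<in> short_periodic L f then 1 else 0)"
    proof -
      have "V \<inter> short_periodic L f = short_periodic L f" by (auto simp: short_periodic_def)
      then show ?thesis using sum.inter_restrict[OF finite_V, of "\<lambda>_. 1::nat" "short_periodic L f"] by simp
    qed
    also have "\<dots> \<le> (\<Sum>v\<in>V. \<Sum>l=1..L. if f \<in> B v l then 1 else 0)"
    proof (rule sum_mono)
      fix v
      show "(if v \<in> short_periodic L f then 1 else 0) \<le> (\<Sum>l=1..L. if f \<in> B v l then 1 else (0::nat))"
      proof (cases "v \<in> short_periodic L f")
        case True
        define l where "l = (LEAST l. 1 \<le> l \<and> (f ^^ l) v = v)"
        obtain l0 where l0: "1 \<le> l0 \<and> (f ^^ l0) v = v" "l0 \<le> L"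
          using True by (auto simp: short_periodic_def)
        have l: "1 \<le> l \<and> (f ^^ l) v = v" unfolding l_def using l0(1) by (rule LeastI)
        have "l \<le> L" unfolding l_def using l0 Least_le[of "\<lambda>l. 1 \<le> l \<and> (f ^^ l) v = v" l0] by linarith
        moreover have "(f ^^ i) v \<noteq> v" if "i \<in> {1..<l}" for i
          using that not_less_Least[of i "\<lambda>l. 1 \<le> l \<and> (f ^^ l) v = v"] by (auto simp: l_def)
        ultimately have "l \<in> {1..L}" "f \<in> B v l" using l f by (auto simp: B_def)
        then have "(if f \<in> B v l then 1 else 0) \<le> (\<Sum>l=1..L. if f \<in> B v l then 1 else (0::nat))"
          by (intro member_le_sum) auto
        then show ?thesis using \<open>f \<in> B v l\<close> True by simp
      qed simp
    qed
    finally show ?thesis .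
  qed
  then have "(\<Sum>f\<in>selections. card (short_periodic L f))
      \<le> (\<Sum>f\<in>selections. \<Sum>v\<in>V. \<Sum>l=1..L. if f \<in> B v l then 1 else 0)"
    by (rule sum_mono)
  also have "\<dots> = (\<Sum>v\<in>V. \<Sum>l=1..L. \<Sum>f\<in>selections. if f \<in> B v l then 1 else 0)"
    by (subst sum.swap, intro sum.cong refl sum.swap)
  also have "\<dots> = (\<Sum>v\<in>V. \<Sum>l=1..L. card (B v l))"
  proof -
    have "selections \<inter> B v l = B v l" for v l by (auto simp: B_def)
    then show ?thesis using finite_selections by (simp add: sum.If_cases)
  qed
  finally have "(\<Sum>f\<in>selections. card (short_periodic L f)) * \<delta> \<le> (\<Sum>v\<in>V. \<Sum>l=1..L. card (B v l)) * \<delta>"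
    by (rule mult_right_mono) simp
  also have "\<dots> = (\<Sum>v\<in>V. \<Sum>l=1..L. card (B v l) * \<delta>)" by (simp add: sum_distrib_right)
  also have "\<dots> \<le> (\<Sum>v\<in>V. \<Sum>l=1..L. card selections)"
    using card_minimal_period[OF _ _ d] by (intro sum_mono) (auto simp: B_def)
  finally show ?thesis by simp
qed

section \<open>Chernoff estimate for the in-degrees\<close>

text \<open>Independence of the choices turns the sum over selections into a product over vertices,
  and 1 + x \<le> exp x bounds each factor. The result is the moment generating function of a
  Poisson variable of mean \<open>card V / \<delta>\<close>.\<close>

lemma sum_exp_in_count:
  assumes u: "u \<in> V" and t: "t \<ge> 0" and \<delta>: "\<delta> > 0" and d: "\<And>v. v \<in> V \<Longrightarrow> \<delta> \<le> real (card (A `` {v}))"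
  shows "(\<Sum>f\<in>selections. exp (t * real (in_count f u)))
    \<le> real (card selections) * exp (real (card V) / \<delta> * (exp t - 1))"
proof -
  have "exp (t * real (in_count f u)) = (\<Prod>v\<in>V. if f v = u then exp t else 1)" for f
  proof -
    have "V \<inter> {v. f v = u} = {v \<in> V. f v = u}" by auto
    then have "(\<Prod>v\<in>V. if f v = u then exp t else 1) = exp t ^ in_count f u"
      using finite_V by (simp add: prod.If_cases in_count_def)
    also have "\<dots> = exp (t * real (in_count f u))" by (simp add: exp_of_nat_mult[symmetric] mult.commute)
    finally show ?thesis by simp
  qed
  then have "(\<Sum>f\<in>selections. exp (t * real (in_count f u)))
      = (\<Sum>f\<in>selections. \<Prod>v\<in>V. if f v = u then exp t else 1)" by simp
  also have "\<dots> = (\<Prod>v\<in>V. \<Sum>w\<in>A `` {v}. if w = u then exp t else 1)"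
    using finite_V finite_Image by (intro prod_sum_PiE[symmetric]) auto
  also have "\<dots> \<le> (\<Prod>v\<in>V. card (A `` {v}) * exp ((exp t - 1) / \<delta>))"
  proof (rule prod_mono, intro conjI)
    fix v assume v: "v \<in> V"
    let ?N = "A `` {v}"
    have fin: "finite ?N" using finite_Image by blast
    show "0 \<le> (\<Sum>w\<in>?N. if w = u then exp t else 1)" by (intro sum_nonneg) auto
    have e: "exp t \<ge> 1" using t by simp
    have "(\<Sum>w\<in>?N. if w = u then exp t else 1) = (\<Sum>w\<in>?N. 1 + (if w = u then exp t - 1 else 0))"
      by (intro sum.cong) auto
    also have "\<dots> = card ?N + (if u \<in> ?N then exp t - 1 else 0)"
      using fin by (simp add: sum.distrib)
    also have "\<dots> \<le> card ?N + card ?N * ((exp t - 1) / \<delta>)"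
    proof -
      have "exp t - 1 = \<delta> * ((exp t - 1) / \<delta>)" using \<delta> by simp
      also have "\<dots> \<le> card ?N * ((exp t - 1) / \<delta>)" using d[OF v] \<delta> e by (intro mult_right_mono) auto
      finally show ?thesis using \<delta> e by auto
    qed
    also have "\<dots> = card ?N * (1 + (exp t - 1) / \<delta>)" by (simp add: algebra_simps)
    also have "\<dots> \<le> card ?N * exp ((exp t - 1) / \<delta>)"
      using exp_ge_add_one_self by (intro mult_left_mono) auto
    finally show "(\<Sum>w\<in>?N. if w = u then exp t else 1) \<le> card ?N * exp ((exp t - 1) / \<delta>)" .
  qed
  also have "\<dots> = real (card selections) * exp (real (card V) / \<delta> * (exp t - 1))"
    by (simp add: prod.distrib card_selections exp_of_nat_mult[symmetric])
  finally show ?thesis .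
qed

text \<open>Truncated subtraction is the positive part of a - q, and x \<le> exp x bounds it by exp
  (t (a - q)) / t.\<close>

lemma sum_excess:
  assumes t: "t > 0" and \<delta>: "\<delta> > 0" and d: "\<And>v. v \<in> V \<Longrightarrow> \<delta> \<le> real (card (A `` {v}))"
  shows "(\<Sum>f\<in>selections. real (excess q f)) \<le>
    real (card selections) * real (card V) * (exp (real (card V) / \<delta> * (exp t - 1) - t * q) / t)"
proof -
  have pt: "real (a - q) \<le> exp (t * real a) * exp (- t * q) / t" for a
  proof (cases "a \<ge> q")
    case True
    have "t * (real a - q) \<le> exp (t * (real a - q))"
      using exp_ge_add_one_self[of "t * (real a - q)"] by linarith
    also have "\<dots> = exp (t * real a) * exp (- t * q)" by (simp add: exp_add[symmetric] algebra_simps)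
    finally show ?thesis using t True by (simp add: field_simps of_nat_diff)
  qed (use t in simp)
  have "(\<Sum>f\<in>selections. real (excess q f)) = (\<Sum>f\<in>selections. \<Sum>u\<in>V. real (in_count f u - q))"
    by (simp add: excess_def)
  also have "\<dots> \<le> (\<Sum>f\<in>selections. \<Sum>u\<in>V. exp (t * real (in_count f u)) * exp (- t * q) / t)"
    by (intro sum_mono pt)
  also have "\<dots> = (\<Sum>u\<in>V. (\<Sum>f\<in>selections. exp (t * real (in_count f u))) * exp (- t * q) / t)"
    by (subst sum.swap) (simp add: sum_distrib_right sum_divide_distrib)
  also have "\<dots> \<le> (\<Sum>u\<in>V. (real (card selections) * exp (real (card V) / \<delta> * (exp t - 1))) * exp (- t * q) / t)"
    using t by (intro sum_mono divide_right_mono mult_right_mono sum_exp_in_count[OF _ _ \<delta> d]) auto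
  also have "\<dots> = real (card selections) * real (card V) * (exp (real (card V) / \<delta> * (exp t - 1) - t * q) / t)"
    by (simp add: exp_diff exp_minus field_simps)
  finally show ?thesis .
qed

section \<open>Long cycles and pruning\<close>

definition orbit_of :: "('a \<Rightarrow> 'a) \<Rightarrow> 'a \<Rightarrow> 'a set" where
  "orbit_of f v = range (\<lambda>i. (f ^^ i) v)"

text \<open>Short cycles contain few vertices altogether and can be deleted completely. Of a long
  cycle only one vertex is deleted, since the number of long cycles is small.\<close>

definition long_periodic :: "nat \<Rightarrow> ('a \<Rightarrow> 'a) \<Rightarrow> 'a set" where
  "long_periodic L f = {v \<in> V. v \<notin> short_periodic L f \<and> (\<exists>l>0. (f ^^ l) v = v)}"

lemma funpow_back:
  assumes "(f ^^ l) v = v" "l > 0"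
  shows "\<exists>j. (f ^^ j) ((f ^^ i) v) = v"
proof -
  have "(f ^^ (l * i)) v = v"
    by (induction i) (auto simp: funpow_add assms(1))
  \<comment> \<open>\<open>l * i\<close> is a multiple of the period and at least \<open>i\<close>,
    so going on from step \<open>i\<close> to step \<open>l * i\<close> ends in
    \<open>v\<close>.\<close>
  moreover have "l * i = (l * i - i) + i" using assms(2) by simp
  ultimately have "(f ^^ (l * i - i)) ((f ^^ i) v) = v" by (metis comp_apply funpow_add)
  then show ?thesis by blast
qed

lemma orbit_of_subset: "x \<in> orbit_of f v \<Longrightarrow> orbit_of f x \<subseteq> orbit_of f v"
  unfolding orbit_of_def by clarify (metis comp_apply funpow_add rangeI)

lemma orbit_of_eq:
  assumes "(f ^^ l) v = v" "l > 0" "x \<in> orbit_of f v"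
  shows "orbit_of f x = orbit_of f v"
proof -
  obtain i where "x = (f ^^ i) v" using assms(3) by (auto simp: orbit_of_def)
  then obtain j where "(f ^^ j) x = v" using funpow_back[OF assms(1,2)] by blast
  then have "v \<in> orbit_of f x" by (auto simp: orbit_of_def)
  then show ?thesis using orbit_of_subset assms(3) by blast
qed

text \<open>Two equal iterates among the first \<open>L + 1\<close> would, carried round the cycle
  back to \<open>v\<close>, yield a period of at most \<open>L\<close>.\<close>

lemma card_long_orbit:
  assumes f: "f \<in> selections" and v: "v \<in> long_periodic L f"
  shows "L < card (orbit_of f v)"
proof -
  have vV: "v \<in> V" using v by (simp add: long_periodic_def)
  have sub: "orbit_of f v \<subseteq> V" using funpow_V[OF f vV] by (auto simp: orbit_of_def)
  obtain l where l: "(f ^^ l) v = v" "l > 0" using v by (auto simp: long_periodic_def)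
  have "(f ^^ i) v \<noteq> (f ^^ j) v" if "i < j" "j \<le> L" for i j
  proof
    assume eq: "(f ^^ i) v = (f ^^ j) v"
    obtain m where m: "(f ^^ m) ((f ^^ i) v) = v" using funpow_back[OF l] by blast
    have "(f ^^ (j - i)) v = (f ^^ (j - i)) ((f ^^ (m + i)) v)" using m by (simp add: funpow_add)
    also have "\<dots> = (f ^^ (j - i + (m + i))) v" by (simp only: funpow_add comp_apply)
    also have "j - i + (m + i) = m + j" using that by simp
    also have "(f ^^ (m + j)) v = v" using m eq by (simp add: funpow_add)
    finally have "(f ^^ (j - i)) v = v" .
    moreover have "j - i \<in> {1..L}" using that by auto
    ultimately show False using v vV by (auto simp: long_periodic_def short_periodic_def)
  qed
  then have "inj_on (\<lambda>i. (f ^^ i) v) {..L}"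
    by (intro linorder_inj_onI) auto
  then have "card ((\<lambda>i. (f ^^ i) v) ` {..L}) = Suc L" by (simp add: card_image)
  moreover have "card ((\<lambda>i. (f ^^ i) v) ` {..L}) \<le> card (orbit_of f v)"
    using finite_subset[OF sub finite_V] by (intro card_mono) (auto simp: orbit_of_def)
  ultimately show ?thesis by simp
qed

lemma card_long_orbits:
  assumes f: "f \<in> selections"
  shows "card (orbit_of f ` long_periodic L f) * Suc L \<le> card V"
proof -
  let ?O = "orbit_of f ` long_periodic L f"
  have sub: "\<Union>?O \<subseteq> V" using funpow_V[OF f] by (auto simp: orbit_of_def long_periodic_def)
  have fin: "finite ?O" using finite_V by (auto simp: long_periodic_def)
  have "card ?O * Suc L = (\<Sum>X\<in>?O. Suc L)" by simp
  also have "\<dots> \<le> (\<Sum>X\<in>?O. card X)"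
    using card_long_orbit[OF f] by (intro sum_mono) (auto simp: Suc_le_eq)
  also have "\<dots> = card (\<Union>?O)"
  proof (rule card_Union_disjoint[symmetric])
    show "pairwise disjnt ?O"
    proof (intro pairwiseI, clarify)
      fix v w assume vw: "v \<in> long_periodic L f" "w \<in> long_periodic L f" "orbit_of f v \<noteq> orbit_of f w"
      then show "disjnt (orbit_of f v) (orbit_of f w)"
        unfolding disjnt_def long_periodic_def using orbit_of_eq by blast
    qed
    show "finite X" if "X \<in> ?O" for X using that sub finite_V finite_subset by (metis Union_upper)
  qed
  also have "\<dots> \<le> card V" using sub finite_V by (intro card_mono) auto
  finally show ?thesis .
qed

text \<open>The excess over \<open>h - 1\<close> instead of \<open>h\<close> counts a vertex as soon
  as its in-degree is \<open>h\<close>; thus it bounds the saturated vertices as well as the surplus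
  arcs.\<close>

lemma prune_selection:
  assumes f: "f \<in> selections" and h: "h \<ge> 1"
  shows "\<exists>E. in_forest h E \<and> (\<forall>(v, w)\<in>E. f v = w) \<and>
    card (roots E) \<le> excess (h - 1) f + card (short_periodic L f) + card V div Suc L \<and>
    card (saturated h E) \<le> excess (h - 1) f"
proof -
  have "\<exists>P\<subseteq>{v \<in> V. f v = u}. card P = min h (in_count f u)" for u
    by (rule obtain_subset_with_card_n[of "min h (in_count f u)" "{v \<in> V. f v = u}"])
      (auto simp: in_count_def)
  then obtain P where P: "\<And>u. P u \<subseteq> {v \<in> V. f v = u}" "\<And>u. card (P u) = min h (in_count f u)"
    by metis
  \<comment> \<open>Dropped are the choices of all preimages beyond \<open>h\<close> of a vertex, of
    all vertices on short cycles, and of one vertex on each long cycle.\<close>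
  define S1 where "S1 = (\<Union>u\<in>V. {v \<in> V. f v = u} - P u)"
  define S2 where "S2 = short_periodic L f"
  define S3 where "S3 = (\<lambda>X. SOME x. x \<in> X) ` orbit_of f ` long_periodic L f"
  define E where "E = {(v, f v) | v. v \<in> V - (S1 \<union> S2 \<union> S3)}"
  have finP: "finite (P u)" for u using P(1)[of u] finite_V finite_subset by fastforce
  have c1: "card S1 \<le> excess (h - 1) f"
  proof -
    have "card S1 \<le> (\<Sum>u\<in>V. card ({v \<in> V. f v = u} - P u))"
      unfolding S1_def using finite_V by (rule card_UN_le)
    also have "\<dots> \<le> (\<Sum>u\<in>V. in_count f u - (h - 1))"
    proof (rule sum_mono)
      fix u
      have "card ({v \<in> V. f v = u} - P u) = in_count f u - min h (in_count f u)"
        using P[of u] finP by (simp add: card_Diff_subset in_count_def)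
      then show "card ({v \<in> V. f v = u} - P u) \<le> in_count f u - (h - 1)" by simp
    qed
    finally show ?thesis by (simp add: excess_def)
  qed
  have c3: "card S3 \<le> card V div Suc L"
  proof -
    have "card S3 \<le> card (orbit_of f ` long_periodic L f)"
      unfolding S3_def using finite_V by (intro card_image_le) (auto simp: long_periodic_def)
    then show ?thesis using card_long_orbits[OF f, of L]
      by (metis div_le_mono le_trans nonzero_mult_div_cancel_right old.nat.distinct(2))
  qed
  have fin: "finite (S1 \<union> S2 \<union> S3)"
    using finite_V by (auto simp: S1_def S2_def S3_def short_periodic_def long_periodic_def)
  have "roots E \<subseteq> S1 \<union> S2 \<union> S3" by (auto simp: roots_def E_def)
  then have "card (roots E) \<le> card (S1 \<union> S2 \<union> S3)" using fin by (rule card_mono[rotated])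
  also have "\<dots> \<le> card S1 + card S2 + card S3"
    using card_Un_le[of "S1 \<union> S2" S3] card_Un_le[of S1 S2] by linarith
  finally have cr: "card (roots E) \<le> excess (h - 1) f + card (short_periodic L f) + card V div Suc L"
    using c1 c3 by (simp add: S2_def)
  have sub_in: "E\<inverse> `` {u} \<subseteq> {v \<in> V. f v = u}" for u by (auto simp: E_def)
  have sat: "card (saturated h E) \<le> excess (h - 1) f"
  proof -
    have "card (saturated h E) = (\<Sum>u\<in>saturated h E. 1)" by simp
    also have "\<dots> \<le> (\<Sum>u\<in>saturated h E. in_count f u - (h - 1))"
    proof (rule sum_mono)
      fix u assume "u \<in> saturated h E"
      then have "h \<le> card (E\<inverse> `` {u})" by (simp add: saturated_def)
      also have "\<dots> \<le> in_count f u" unfolding in_count_def using sub_in finite_V by (intro card_mono) auto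
      finally show "1 \<le> in_count f u - (h - 1)" using h by simp
    qed
    also have "\<dots> \<le> excess (h - 1) f"
      unfolding excess_def using finite_V by (intro sum_mono2) (auto simp: saturated_def)
    finally show ?thesis .
  qed
  have "card (E\<inverse> `` {u}) \<le> h" for u
  proof -
    have "E\<inverse> `` {u} \<subseteq> P u"
    proof
      fix v assume "v \<in> E\<inverse> `` {u}"
      then have v: "v \<in> V" "f v = u" "v \<notin> S1" by (auto simp: E_def)
      then show "v \<in> P u" using selections_V[OF f v(1)] by (auto simp: S1_def)
    qed
    then have "card (E\<inverse> `` {u}) \<le> card (P u)" using finP by (rule card_mono[rotated])
    then show ?thesis using P(2)[of u] by simp
  qed
  moreover have "E \<subseteq> A" using f by (auto simp: E_def PiE_iff)
  moreover have "single_valued E" by (auto simp: E_def single_valued_def)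
  moreover have "acyclic E"
  proof (rule acyclicI, intro allI notI)
    \<comment> \<open>A cycle of \<open>E\<close> is the full orbit of v under f and avoids the
      three deleted sets. But v lies in \<open>S2\<close> if its period is short, and otherwise the
      orbit contains its representative in \<open>S3\<close>.\<close>
    fix v assume vv: "(v, v) \<in> E\<^sup>+"
    have shift: "(f x, f x) \<in> E\<^sup>+ \<and> x \<in> V - (S1 \<union> S2 \<union> S3)" if xx: "(x, x) \<in> E\<^sup>+" for x
    proof -
      obtain y where y: "(x, y) \<in> E" "(y, x) \<in> E\<^sup>*" using tranclD[OF xx] by blast
      then have "(y, y) \<in> E\<^sup>+" by (meson rtrancl_into_trancl1)
      then show ?thesis using y(1) by (auto simp: E_def)
    qed
    have orb: "((f ^^ i) v, (f ^^ i) v) \<in> E\<^sup>+" for i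
      by (induction i) (use vv shift in auto)
    have reach: "\<exists>l>0. y = (f ^^ l) x" if "(x, y) \<in> E\<^sup>+" for x y
      using that
    proof induction
      case (base y)
      then show ?case by (intro exI[of _ 1]) (auto simp: E_def)
    next
      case (step y z)
      then obtain l where "l > 0" "y = (f ^^ l) x" by blast
      moreover have "z = f y" using step by (auto simp: E_def)
      ultimately show ?case by (intro exI[of _ "Suc l"]) simp
    qed
    have out: "orbit_of f v \<inter> (S1 \<union> S2 \<union> S3) = {}"
      using orb shift by (fastforce simp: orbit_of_def)
    have vo: "v \<in> orbit_of f v" unfolding orbit_of_def by (rule range_eqI[of _ _ 0]) simp
    have "v \<in> V" using shift vv by blast
    moreover have "v \<notin> short_periodic L f" using out vo by (auto simp: S2_def)
    moreover obtain l where "l > 0" "v = (f ^^ l) v" using reach[OF vv] by blast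
    ultimately have "v \<in> long_periodic L f" by (auto simp: long_periodic_def)
    then have "(SOME x. x \<in> orbit_of f v) \<in> S3" by (auto simp: S3_def)
    moreover have "(SOME x. x \<in> orbit_of f v) \<in> orbit_of f v" using vo by (rule someI)
    ultimately show False using out by blast
  qed
  ultimately have "in_forest h E" by (simp add: in_forest_def)
  moreover have "\<forall>(v, w)\<in>E. f v = w" by (auto simp: E_def)
  ultimately show ?thesis using cr sat by blast
qed

end


section \<open>Counting\<close>

text \<open>Every set X gets the weight \<open>q ^ card X\<close>, which is at least
  \<open>q ^ m\<close> on the sets counted, and the weights of all subsets add up to a power of 1 +
  q. This serves when \<open>m\<close> grows linearly with \<open>card S\<close>, with
  \<open>q\<close> close to the ratio of the two.\<close>

lemma card_subsets_le:
  assumes "finite S" "q > (0::real)" "q \<le> 1"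
  shows "real (card {X. X \<subseteq> S \<and> card X \<le> m}) \<le> (1 + q) ^ card S / q ^ m"
proof -
  have "real (card {X. X \<subseteq> S \<and> card X \<le> m}) * q ^ m = (\<Sum>X\<in>{X. X \<subseteq> S \<and> card X \<le> m}. q ^ m)"
    by simp
  also have "\<dots> \<le> (\<Sum>X\<in>{X. X \<subseteq> S \<and> card X \<le> m}. q ^ card X)"
    using assms by (intro sum_mono power_decreasing) auto
  also have "\<dots> \<le> (\<Sum>X\<in>Pow S. q ^ card X)"
    using assms by (intro sum_mono2) auto
  also have "\<dots> = (\<Prod>x\<in>S. q + 1)"
    using prod_add[OF assms(1), of "\<lambda>_. q" "\<lambda>_. 1"] by simp
  finally show ?thesis using assms(2) by (simp add: field_simps)
qed

text \<open>Cruder than \<open>card_subsets_le\<close>, but polynomial in \<open>card S\<close> when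
  \<open>m\<close> is fixed.\<close>

lemma card_subsets_le_power:
  assumes "finite S"
  shows "card {X. X \<subseteq> S \<and> card X \<le> m} \<le> (card S + 1) ^ m"
proof (induction m)
  case 0
  have "{X. X \<subseteq> S \<and> card X \<le> 0} = {{}}"
    using finite_subset[OF _ assms] by auto
  then show ?case by simp
next
  case (Suc m)
  let ?P = "{X. X \<subseteq> S \<and> card X \<le> m}"
  have fin: "finite ?P" using assms by simp
  have "{X. X \<subseteq> S \<and> card X \<le> Suc m} \<subseteq> (\<lambda>(x, X). insert x X) ` (S \<times> ?P) \<union> ?P"
  proof
    fix X assume X: "X \<in> {X. X \<subseteq> S \<and> card X \<le> Suc m}"
    show "X \<in> (\<lambda>(x, X). insert x X) ` (S \<times> ?P) \<union> ?P"
    proof (cases "X = {}")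
      case False
      then obtain x where x: "x \<in> X" by auto
      have "finite X" using X assms finite_subset by auto
      then have "X - {x} \<in> ?P" using X x by auto
      moreover have "X = insert x (X - {x})" using x by auto
      ultimately show ?thesis using X x by (auto intro!: rev_image_eqI[of "(x, X - {x})"])
    qed simp
  qed
  then have "card {X. X \<subseteq> S \<and> card X \<le> Suc m} \<le> card ((\<lambda>(x, X). insert x X) ` (S \<times> ?P) \<union> ?P)"
    using assms fin by (intro card_mono) auto
  also have "\<dots> \<le> card ((\<lambda>(x, X). insert x X) ` (S \<times> ?P)) + card ?P" by (rule card_Un_le)
  also have "\<dots> \<le> card S * card ?P + card ?P"
    using card_image_le[of "S \<times> ?P" "\<lambda>(x, X). insert x X"] assms fin
    by (simp add: card_cartesian_product)
  also have "\<dots> = (card S + 1) * card ?P" by simp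
  also have "\<dots> \<le> (card S + 1) * (card S + 1) ^ m" using Suc by (rule mult_left_mono) simp
  finally show ?case by simp
qed

context host_graph
begin

section \<open>From rooted forests to spanning trees\<close>

lemma in_forest_reaches_root:
  assumes E: "in_forest h E" and v: "v \<in> V"
  shows "\<exists>r\<in>roots E. (v, r) \<in> E\<^sup>*"
proof -
  have EA: "E \<subseteq> A" and ac: "acyclic E" using E by (auto simp: in_forest_def)
  have "wf (E\<inverse>)" using finite_sub[OF EA] ac by (rule finite_acyclic_wf_converse)
  then show ?thesis using v
  proof (induction v rule: wf_induct_rule)
    case (less v)
    show ?case
    proof (cases "v \<in> roots E")
      case False
      then obtain w where w: "(v, w) \<in> E" using less.prems by (auto simp: roots_def)
      then have "w \<in> V" using EA A_V by blast
      then show ?thesis using less.IH[of w] w by (auto intro: converse_rtrancl_into_rtrancl)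
    qed auto
  qed
qed

text \<open>At most \<open>h\<close> children and one parent make every degree at most
  \<open>Suc h\<close>, strictly below \<open>k\<close> as \<open>connect_forest\<close>
  demands.\<close>

lemma connect_in_forest:
  assumes E: "in_forest h E" "card (roots E) \<le> c" and h: "Suc h < k" and k: "k \<ge> 2"
    and \<delta>: "\<And>v. v \<in> V \<Longrightarrow> \<delta> \<le> card (A `` {v})" "card V < k * (\<delta> - (10 * c + 2))"
    and conn: "\<And>u v. u \<in> V \<Longrightarrow> v \<in> V \<Longrightarrow> (u, v) \<in> A\<^sup>*"
  shows "\<exists>F. tame_forest k F \<and> (\<forall>u\<in>V. \<forall>v\<in>V. (u, v) \<in> F\<^sup>*) \<and>
    card ((F - (E \<union> E\<inverse>)) \<union> ((E \<union> E\<inverse>) - F)) \<le> 10 * c"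
proof (rule connect_forest[OF _ _ _ k _ _ E(2) \<delta> conn])
  have EA: "E \<subseteq> A" using E by (auto simp: in_forest_def)
  show "uforest (E \<union> E\<inverse>)" using E by (intro uforest_of_acyclic) (auto simp: in_forest_def)
  show "E \<union> E\<inverse> \<subseteq> A" using EA A_sym by auto
  show "roots E \<subseteq> V" by (auto simp: roots_def)
  show "card ((E \<union> E\<inverse>) `` {x}) < k" for x
  proof -
    have "card (E `` {x}) \<le> 1"
    proof (cases "E `` {x} = {}")
      case False
      then obtain y where "(x, y) \<in> E" by auto
      then have "E `` {x} = {y}" using E by (auto simp: in_forest_def dest: single_valuedD)
      then show ?thesis by simp
    qed simp
    moreover have "card (E\<inverse> `` {x}) \<le> h" using E by (simp add: in_forest_def)
    moreover have "card ((E \<union> E\<inverse>) `` {x}) \<le> card (E `` {x}) + card (E\<inverse> `` {x})"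
      by (simp add: Un_Image card_Un_le)
    ultimately show ?thesis using h by linarith
  qed
  show "V \<subseteq> (E \<union> E\<inverse>)\<^sup>* `` roots E"
  proof
    fix v assume "v \<in> V"
    then obtain r where r: "r \<in> roots E" "(v, r) \<in> E\<^sup>*" using in_forest_reaches_root[OF E(1)] by blast
    then have "(r, v) \<in> (E\<inverse>)\<^sup>*" by (simp add: rtrancl_converse)
    moreover have "(E\<inverse>)\<^sup>* \<subseteq> (E \<union> E\<inverse>)\<^sup>*" by (rule rtrancl_mono) auto
    ultimately show "v \<in> (E \<union> E\<inverse>)\<^sup>* `` roots E" using r(1) by blast
  qed
qed

text \<open>The tree and the set of changed arcs give back the undirected edges of the forest, and
  its roots orient them by \<open>orientation_unique\<close>. The two extra factors count the
  possible sets of changed arcs and of roots.\<close>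

lemma forests_le_trees:
  assumes h: "Suc h < k" and V: "V \<noteq> {}"
    and \<delta>: "\<And>v. v \<in> V \<Longrightarrow> \<delta> \<le> card (A `` {v})" "card V < k * (\<delta> - (10 * c + 2))"
    and conn: "\<And>u v. u \<in> V \<Longrightarrow> v \<in> V \<Longrightarrow> (u, v) \<in> A\<^sup>*"
    and G: "pair_graph G" "pverts G = V" "parcs G = A"
  shows "card {E. in_forest h E \<and> card (roots E) \<le> c} \<le>
    num_bounded_spanning_trees k G * ((card V * card V + 1) ^ (10 * c) * (card V + 1) ^ c)"
proof -
  let ?Q = "{E. in_forest h E \<and> card (roots E) \<le> c}"
  define good where "good E F \<longleftrightarrow> tame_forest k F \<and> (\<forall>u\<in>V. \<forall>v\<in>V. (u, v) \<in> F\<^sup>*) \<and>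
      card ((F - (E \<union> E\<inverse>)) \<union> ((E \<union> E\<inverse>) - F)) \<le> 10 * c" for E F
  have k: "k \<ge> 2" using h by simp
  define \<phi> where "\<phi> E = (SOME F. good E F)" for E
  have \<phi>: "good E (\<phi> E)" if "E \<in> ?Q" for E
  proof -
    have "\<exists>F. good E F"
      unfolding good_def using that by (intro connect_in_forest[OF _ _ h k \<delta> conn]) auto
    then show ?thesis unfolding \<phi>_def by (rule someI_ex)
  qed
  define T where "T E = (\<lparr>pverts = V, parcs = \<phi> E\<rparr>,
    (\<phi> E - (E \<union> E\<inverse>)) \<union> ((E \<union> E\<inverse>) - \<phi> E), roots E)" for E
  let ?B = "bounded_spanning_trees k G \<times> {X. X \<subseteq> V \<times> V \<and> card X \<le> 10 * c} \<times> {X. X \<subseteq> V \<and> card X \<le> c}"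
  have "inj_on T ?Q"
  proof (rule inj_onI)
    fix E1 E2 assume E1: "E1 \<in> ?Q" and E2: "E2 \<in> ?Q" and eq: "T E1 = T E2"
    have sub: "E1 \<subseteq> A" "E2 \<subseteq> A" using E1 E2 by (auto simp: in_forest_def)
    have F: "\<phi> E1 = \<phi> E2" and d: "(\<phi> E1 - (E1 \<union> E1\<inverse>)) \<union> ((E1 \<union> E1\<inverse>) - \<phi> E1) =
        (\<phi> E2 - (E2 \<union> E2\<inverse>)) \<union> ((E2 \<union> E2\<inverse>) - \<phi> E2)" and r: "roots E1 = roots E2"
      using eq unfolding T_def prod.inject pair_pre_digraph.ext_inject by (iprover elim: conjE)+
    have "X = Y" if "(F - X) \<union> (X - F) = (F - Y) \<union> (Y - F)" for F X Y :: "('a \<times> 'a) set"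
    proof (rule set_eqI)
      fix e
      have "e \<in> (F - X) \<union> (X - F) \<longleftrightarrow> e \<in> (F - Y) \<union> (Y - F)" using that by simp
      then show "e \<in> X \<longleftrightarrow> e \<in> Y" by blast
    qed
    from this[OF d[unfolded F]] have sd: "E1 \<union> E1\<inverse> = E2 \<union> E2\<inverse>" .
    have "Domain E1 \<subseteq> V" "Domain E2 \<subseteq> V" using sub A_V by auto
    then have dom: "Domain E1 = Domain E2" using r unfolding roots_def by blast
    have "acyclic E1" "single_valued E1" "acyclic E2" "single_valued E2"
      using E1 E2 by (auto simp: in_forest_def)
    then show "E1 = E2"
      using orientation_unique[OF finite_sub[OF sub(1)] _ _ finite_sub[OF sub(2)] _ _ dom sd] by blast
  qed
  moreover have "T ` ?Q \<subseteq> ?B"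
  proof (rule image_subsetI)
    fix E assume E: "E \<in> ?Q"
    have tf: "uforest (\<phi> E)" "\<phi> E \<subseteq> A" "\<And>v. card (\<phi> E `` {v}) \<le> k"
      using \<phi>[OF E] by (auto simp: good_def tame_forest_def)
    have "\<lparr>pverts = pverts G, parcs = \<phi> E\<rparr> \<in> bounded_spanning_trees k G"
      using \<phi>[OF E] tf V G by (intro bounded_spanning_treeI) (auto simp: good_def)
    moreover have "E \<subseteq> A" using E by (simp add: in_forest_def)
    then have "(\<phi> E - (E \<union> E\<inverse>)) \<union> ((E \<union> E\<inverse>) - \<phi> E) \<subseteq> V \<times> V"
      using tf(2) A_subset by blast
    moreover have "roots E \<subseteq> V" by (auto simp: roots_def)
    ultimately show "T E \<in> ?B" using \<phi>[OF E] E G by (simp add: T_def good_def)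
  qed
  moreover have "finite ?B"
    using finite_V finite_bounded_spanning_trees[OF G(1)] by simp
  ultimately have "card ?Q \<le> card ?B" by (rule card_inj_on_le)
  also have "\<dots> = num_bounded_spanning_trees k G *
      (card {X. X \<subseteq> V \<times> V \<and> card X \<le> 10 * c} * card {X. X \<subseteq> V \<and> card X \<le> c})"
    by (simp add: card_cartesian_product num_bounded_spanning_trees_def)
  also have "\<dots> \<le> num_bounded_spanning_trees k G * ((card V * card V + 1) ^ (10 * c) * (card V + 1) ^ c)"
    using card_subsets_le_power[of "V \<times> V" "10 * c"] card_subsets_le_power[of V c] finite_V
    by (intro mult_left_mono mult_mono) (auto simp: card_cartesian_product)
  finally show ?thesis .
qed

end

section \<open>Typical selections\<close>

text \<open>Here s is both the scale of the surplus in the minimum degree and the Chernoff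
  parameter. Since k s^2 = ln k, the exponent is at most 3 s - 2 ln k / (1 + 3 s). The left side is
  thus at most of order k to the power -9/5 divided by s, where 1 / s is of order sqrt (k / ln k),
  and this falls below any constant multiple of 1 / k.\<close>

lemma chernoff_bound_eventually:
  "eventually (\<lambda>k. let s = sqrt (ln k / k) in
     exp (k / (1 + 3 * s) * (exp s - 1) - s * (k - 3)) / s \<le> 1 / (4000 * k)) at_top"
proof -
  have "eventually (\<lambda>k::real. sqrt (ln k / k) \<le> 1 / 30) at_top" by real_asymp
  moreover have "eventually (\<lambda>k::real. exp (1 / 10 - 9 / 5 * ln k) / sqrt (ln k / k) \<le> 1 / (4000 * k)) at_top"
    by real_asymp
  moreover have "eventually (\<lambda>k::real. k > 1) at_top" by real_asymp
  ultimately show ?thesis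
  proof eventually_elim
    case (elim k)
    define s where "s = sqrt (ln k / k)"
    \<comment> \<open>1/30 yields 3 s \<le> 1/10 and 2 / (1 + 3 s) \<ge> 9/5.\<close>
    have s: "s > 0" "s \<le> 1/30" using elim by (auto simp: s_def)
    have s2: "k * s\<^sup>2 = ln k" using elim by (simp add: s_def)
    have "exp s \<le> 1 + s + s\<^sup>2" using exp_bound[of s] s by auto
    then have "k / (1 + 3 * s) * (exp s - 1) \<le> k / (1 + 3 * s) * (s + s\<^sup>2)"
      using elim s by (intro mult_left_mono) auto
    also have "\<dots> = k * s - 2 * (k * s\<^sup>2) / (1 + 3 * s)"
      using s by (simp add: field_simps power2_eq_square)
    finally have "k / (1 + 3 * s) * (exp s - 1) - s * (k - 3) \<le> 3 * s - 2 * ln k / (1 + 3 * s)"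
      using s2 by (simp add: algebra_simps)
    also have "\<dots> \<le> 1 / 10 - 9 / 5 * ln k"
    proof -
      have "9 / 5 * ln k * (1 + 3 * s) \<le> 9/5 * ln k * (10/9)"
        using elim s by (intro mult_left_mono) auto
      then have "9 / 5 * ln k \<le> 2 * ln k / (1 + 3 * s)" using s by (simp add: field_simps)
      then show ?thesis using s by simp
    qed
    finally have "exp (k / (1 + 3 * s) * (exp s - 1) - s * (k - 3)) / s \<le> exp (1 / 10 - 9 / 5 * ln k) / s"
      using s by (intro divide_right_mono) auto
    also have "\<dots> \<le> 1 / (4000 * k)" using elim by (simp add: s_def)
    finally show ?case by (simp add: Let_def s_def)
  qed
qed

text \<open>Markov's inequality in counting form.\<close>

lemma card_large_values_le:
  fixes g :: "'b \<Rightarrow> real"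
  assumes "finite S" "\<And>x. x \<in> S \<Longrightarrow> 0 \<le> g x" "a > 0" "sum g S \<le> B"
  shows "real (card {x \<in> S. a < g x}) \<le> B / a"
proof -
  have "real (card {x \<in> S. a < g x}) * a = (\<Sum>x\<in>{x \<in> S. a < g x}. a)" by simp
  also have "\<dots> \<le> (\<Sum>x\<in>{x \<in> S. a < g x}. g x)" by (intro sum_mono) auto
  also have "\<dots> \<le> sum g S" using assms by (intro sum_mono2) auto
  finally show ?thesis using assms by (simp add: field_simps)
qed

lemma le_div_if_real_le:
  assumes "real a \<le> real n / real q" "q > 0"
  shows "a \<le> n div q"
proof -
  have "real a * real q \<le> real n" using assms by (simp add: field_simps)
  then have "a * q \<le> n" by (metis of_nat_le_iff of_nat_mult)
  then show ?thesis using assms(2) by (simp add: less_eq_div_iff_mult_less_eq)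
qed

context host_graph
begin

text \<open>Both quantities have a mean of at most a quarter of their threshold: n / (4000 k) for
  the excess by the Chernoff estimate, and 1000 k^2 for the short cycles, from the period bound 1000
  k times n / \<delta> \<le> k. By Markov each spoils at most a quarter of the selections.\<close>

lemma half_of_selections_tame:
  fixes k \<delta> :: nat and s :: real
  assumes k: "k \<ge> 5" and V: "V \<noteq> {}" and s: "s > 0"
    and num: "exp (real k / (1 + 3 * s) * (exp s - 1) - s * (real k - 3)) / s \<le> 1 / (4000 * real k)"
    and deg: "\<And>v. v \<in> V \<Longrightarrow> \<delta> \<le> card (A `` {v})"
    and \<delta>: "real (card V) / real k * (1 + 3 * s) \<le> real \<delta>"
  shows "real (card selections) \<le> 2 * real (card {f \<in> selections.
    real (excess (k - 3) f) \<le> real (card V) / (1000 * real k) \<and>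
    real (card (short_periodic (1000 * k) f)) \<le> 4000 * (real k)\<^sup>2})"
proof -
  define n where "n = real (card V)"
  define N where "N = real (card selections)"
  let ?B1 = "{f \<in> selections. n / (1000 * real k) < real (excess (k - 3) f)}"
  let ?B2 = "{f \<in> selections. 4000 * (real k)\<^sup>2 < real (card (short_periodic (1000 * k) f))}"
  let ?\<Phi> = "{f \<in> selections. real (excess (k - 3) f) \<le> n / (1000 * real k) \<and>
    real (card (short_periodic (1000 * k) f)) \<le> 4000 * (real k)\<^sup>2}"
  have n: "n > 0" using V finite_V by (simp add: n_def card_gt_0_iff)
  have dr: "n / real k * (1 + 3 * s) \<le> real (card (A `` {v}))" if "v \<in> V" for v
    using deg[OF that] \<delta> by (simp add: n_def)
  have pos: "n / real k * (1 + 3 * s) > 0" using n k s by (intro mult_pos_pos divide_pos_pos) auto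
  have "(\<Sum>f\<in>selections. real (excess (k - 3) f)) \<le> N * n *
      (exp (n / (n / real k * (1 + 3 * s)) * (exp s - 1) - s * real (k - 3)) / s)"
    unfolding N_def n_def by (rule sum_excess[OF s pos[unfolded n_def] dr[unfolded n_def]])
  also have "n / (n / real k * (1 + 3 * s)) = real k / (1 + 3 * s)" using n by simp
  also have "real (k - 3) = real k - 3" using k by (simp add: of_nat_diff)
  also have "N * n * (exp (real k / (1 + 3 * s) * (exp s - 1) - s * (real k - 3)) / s) \<le>
      N * n * (1 / (4000 * real k))"
    using num n by (intro mult_left_mono) (auto simp: N_def)
  finally have "real (card ?B1) \<le> N * n * (1 / (4000 * real k)) / (n / (1000 * real k))"
    using n k finite_selections by (intro card_large_values_le) auto
  then have b1: "real (card ?B1) \<le> N / 4" using n k by simp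
  have "(\<Sum>f\<in>selections. card (short_periodic (1000 * k) f)) * \<delta> \<le>
      card V * (1000 * k) * card selections" using deg by (rule sum_short_periodic)
  then have "real ((\<Sum>f\<in>selections. card (short_periodic (1000 * k) f)) * \<delta>) \<le>
      real (card V * (1000 * k) * card selections)" by (rule of_nat_mono)
  then have short: "(\<Sum>f\<in>selections. real (card (short_periodic (1000 * k) f))) * real \<delta> \<le> n * (1000 * real k) * N"
    by (simp add: n_def N_def)
  have "(\<Sum>f\<in>selections. real (card (short_periodic (1000 * k) f))) * (n / real k) \<le>
      (\<Sum>f\<in>selections. real (card (short_periodic (1000 * k) f))) * real \<delta>"
  proof (rule mult_left_mono)
    have "n / real k * 1 \<le> n / real k * (1 + 3 * s)" using n s by (intro mult_left_mono) auto
    then show "n / real k \<le> real \<delta>" using \<delta> by (simp add: n_def)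
  qed (simp add: sum_nonneg)
  also note short
  finally have "(\<Sum>f\<in>selections. real (card (short_periodic (1000 * k) f))) \<le> 1000 * (real k)\<^sup>2 * N"
    using n k by (simp add: field_simps power2_eq_square)
  then have "real (card ?B2) \<le> 1000 * (real k)\<^sup>2 * N / (4000 * (real k)\<^sup>2)"
    using k finite_selections by (intro card_large_values_le) auto
  then have b2: "real (card ?B2) \<le> N / 4" using k by simp
  have "selections \<subseteq> ?\<Phi> \<union> (?B1 \<union> ?B2)" by auto
  then have "card selections \<le> card (?\<Phi> \<union> (?B1 \<union> ?B2))"
    using finite_selections by (intro card_mono) auto
  also have "\<dots> \<le> card ?\<Phi> + (card ?B1 + card ?B2)"
    using card_Un_le[of ?\<Phi> "?B1 \<union> ?B2"] card_Un_le[of ?B1 ?B2] by linarith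
  finally have "real (card selections) \<le> real (card ?\<Phi> + (card ?B1 + card ?B2))"
    by (rule of_nat_mono)
  then have "N \<le> real (card ?\<Phi>) + (real (card ?B1) + real (card ?B2))"
    by (simp only: N_def of_nat_add)
  then show ?thesis using b1 b2 unfolding N_def n_def by linarith
qed

text \<open>The parameters are h = k - 2, L = 1000 k, c = 8 k and b = n / (8 k). With these, at most
  n / (4 k) neighbours are excluded at each new choice, less than half of the minimum
  degree.\<close>

lemma degree_prod_le_trees:
  fixes k \<delta> :: nat and s :: real
  assumes k: "k \<ge> 5" and V: "V \<noteq> {}" and s: "s > 0"
    and num: "exp (real k / (1 + 3 * s) * (exp s - 1) - s * (real k - 3)) / s \<le> 1 / (4000 * real k)"
    and deg: "\<And>v. v \<in> V \<Longrightarrow> \<delta> \<le> card (A `` {v})"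
    and \<delta>: "real (card V) / real k * (1 + 3 * s) \<le> real \<delta>"
    and n1: "real (card V) \<ge> 500000 * real k ^ 3"
    and n2: "3 * s * real (card V) > real k * (80 * real k + 2)"
    and conn: "\<And>u v. u \<in> V \<Longrightarrow> v \<in> V \<Longrightarrow> (u, v) \<in> A\<^sup>*"
    and G: "pair_graph G" "pverts G = V" "parcs G = A"
  shows "real (card selections) \<le> 2 * (200 * real k) ^ (card V div (100 * k)) *
    (1 + 1 / (100 * real k)) ^ card V * real (card V) ^ (8 * k) *
    (real (num_bounded_spanning_trees k G) *
      ((real (card V) * real (card V) + 1) ^ (80 * k) * (real (card V) + 1) ^ (8 * k)))"
proof -
  define n where "n = card V"
  define m where "m = n div (100 * k)"
  define b where "b = n div (8 * k)"
  define \<Phi> where "\<Phi> = {f \<in> selections. real (excess (k - 3) f) \<le> real n / (1000 * real k) \<and>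
    real (card (short_periodic (1000 * k) f)) \<le> 4000 * (real k)\<^sup>2}"
  have half: "real (card selections) \<le> 2 * real (card \<Phi>)"
    unfolding \<Phi>_def n_def by (rule half_of_selections_tame[OF k V s num deg \<delta>])
  \<comment> \<open>In units of n / (1000 k): the vertices on short cycles, bounded independently of
    n, cost at most 8, the excess 1 and the long cycles 1. The total 10 is the bound n / (100 k)
    behind \<open>m\<close>.\<close>
  have n1': "4000 * (real k)\<^sup>2 \<le> 8 * (real n / (1000 * real k))"
    using n1 k by (simp add: n_def field_simps power2_eq_square power3_eq_cube)
  have nk: "real n / (100 * real k) = 10 * (real n / (1000 * real k))"
    "real n / (8 * real k) = 125 * (real n / (1000 * real k))" using k by auto
  have nonneg: "0 \<le> real n / (1000 * real k)" by simp
  have prune: "\<exists>E. in_forest (k - 2) E \<and> (\<forall>(v, w)\<in>E. f v = w) \<and>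
      card (roots E) \<le> m \<and> card (saturated (k - 2) E) + card (roots E) \<le> b" if f: "f \<in> \<Phi>" for f
  proof -
    have "f \<in> selections" using f by (simp add: \<Phi>_def)
    moreover have "k - 2 - 1 = k - 3" "k - 2 \<ge> 1" using k by auto
    ultimately obtain E where E: "in_forest (k - 2) E" "\<forall>(v, w)\<in>E. f v = w"
      "card (roots E) \<le> excess (k - 3) f + card (short_periodic (1000 * k) f) + card V div Suc (1000 * k)"
      "card (saturated (k - 2) E) \<le> excess (k - 3) f"
      using prune_selection[of f "k - 2" "1000 * k"] by auto
    have ex: "real (excess (k - 3) f) \<le> real n / (1000 * real k)"
      and sh: "real (card (short_periodic (1000 * k) f)) \<le> 4000 * (real k)\<^sup>2"
      using f by (auto simp: \<Phi>_def)
    have "real (card V div Suc (1000 * k)) \<le> real n / real (Suc (1000 * k))"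
      unfolding n_def by (rule of_nat_div_le_of_nat)
    also have "\<dots> \<le> real n / (1000 * real k)" using k by (intro divide_left_mono) auto
    finally have lo: "real (card V div Suc (1000 * k)) \<le> real n / (1000 * real k)" .
    have r: "real (card (roots E)) \<le> real n / (100 * real k)"
      using of_nat_mono[OF E(3), where 'a = real] ex sh lo n1' unfolding nk(1) by simp
    have "real (card (saturated (k - 2) E) + card (roots E)) \<le> real n / (8 * real k)"
      using r of_nat_mono[OF E(4), where 'a = real] ex nonneg unfolding nk by simp
    then have "card (saturated (k - 2) E) + card (roots E) \<le> b"
      unfolding b_def using k by (intro le_div_if_real_le) auto
    moreover have "card (roots E) \<le> m"
      unfolding m_def using r k by (intro le_div_if_real_le) auto
    ultimately show ?thesis using E by blast
  qed
  have d: "2 * (b + card V div (8 * k)) \<le> card (A `` {v})" if "v \<in> V" for v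
  proof -
    have "real (n div (8 * k)) \<le> real n / real (8 * k)" by (rule of_nat_div_le_of_nat)
    then have "real (2 * (b + card V div (8 * k))) \<le> real n / real k * (1 / 2)" by (simp add: b_def n_def)
    also have "\<dots> \<le> real n / real k * (1 + 3 * s)" using s by (intro mult_left_mono) auto
    also have "\<dots> \<le> real (card (A `` {v}))" using \<delta> deg[OF that] by (simp add: n_def)
    finally show ?thesis by linarith
  qed
  \<comment> \<open>The surplus 3 s n in k \<delta> exceeds k (10 c + 2) for c = 8 k, as the joining
    of the trees requires.\<close>
  have \<delta>': "card V < k * (\<delta> - (10 * (8 * k) + 2))"
  proof -
    have "real n * (1 + 3 * s) \<le> real k * real \<delta>" using \<delta> k by (simp add: n_def field_simps)
    then have *: "real n + real k * (80 * real k + 2) < real k * real \<delta>"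
      using n2 by (simp add: n_def algebra_simps)
    have "real k * (80 * real k + 2) < real k * real \<delta>" using * by linarith
    then have "80 * real k + 2 < real \<delta>" using k by simp
    then have "real (\<delta> - (10 * (8 * k) + 2)) = real \<delta> - (80 * real k + 2)"
      by (simp add: of_nat_diff)
    then have "real (k * (\<delta> - (10 * (8 * k) + 2))) = real k * (real \<delta> - (80 * real k + 2))"
      by (simp only: of_nat_mult)
    also have "\<dots> > real n" using * by (simp add: algebra_simps)
    finally have "real n < real (k * (\<delta> - (10 * (8 * k) + 2)))" .
    then show ?thesis by (simp only: n_def of_nat_less_iff)
  qed
  have \<Phi>: "\<Phi> \<subseteq> selections" by (auto simp: \<Phi>_def)
  have k8: "8 * k > 0" and kh: "Suc (k - 2) < k" using k by auto
  let ?Q = "{E. in_forest (k - 2) E \<and> card (roots E) \<le> 8 * k}"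
  have Q: "real (card ?Q) \<le> real (num_bounded_spanning_trees k G) *
      ((real n * real n + 1) ^ (80 * k) * (real n + 1) ^ (8 * k))"
    using of_nat_mono[OF forests_le_trees[OF kh V deg \<delta>' conn G], where 'a = real]
    by (simp add: n_def add.commute)
  have S: "real (card {S. S \<subseteq> V \<and> card S \<le> m}) \<le> (1 + 1 / (100 * real k)) ^ n * (100 * real k) ^ m"
  proof -
    have "1 / (100 * real k) > 0" "1 / (100 * real k) \<le> 1" using k by auto
    from card_subsets_le[OF finite_V this, of m]
    have "real (card {S. S \<subseteq> V \<and> card S \<le> m}) \<le>
        (1 + 1 / (100 * real k)) ^ n / (1 / (100 * real k)) ^ m"
      by (simp only: n_def)
    also have "(1 / (100 * real k)) ^ m = 1 / (100 * real k) ^ m" by (simp only: power_one_over)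
    finally show ?thesis by (simp only: divide_divide_eq_right div_by_1)
  qed
  have "real (card \<Phi>) \<le> 2 ^ m * real (card {S. S \<subseteq> V \<and> card S \<le> m}) * real n ^ (8 * k) * real (card ?Q)"
    unfolding n_def by (rule selections_le_forests[OF \<Phi> V k8 prune d])
  also have "\<dots> \<le> 2 ^ m * ((1 + 1 / (100 * real k)) ^ n * (100 * real k) ^ m) * real n ^ (8 * k) *
      (real (num_bounded_spanning_trees k G) *
      ((real n * real n + 1) ^ (80 * k) * (real n + 1) ^ (8 * k)))"
  proof -
    have gen: "a * x * c * q \<le> a * y * c * r" if "0 \<le> a" "0 \<le> c" "0 \<le> x" "0 \<le> q" "x \<le> y" "q \<le> r"
      for a c x y q r :: real
      using that by (intro mult_mono mult_left_mono mult_right_mono mult_nonneg_nonneg) auto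
    show ?thesis by (rule gen[OF _ _ _ _ S Q]) simp_all
  qed
  also have "2 ^ m * ((1 + 1 / (100 * real k)) ^ n * (100 * real k) ^ m) =
      (200 * real k) ^ m * (1 + 1 / (100 * real k)) ^ n"
  proof -
    have "200 * real k = 2 * (100 * real k)" by simp
    then have "(200 * real k) ^ m = 2 ^ m * (100 * real k) ^ m" by (simp only: power_mult_distrib)
    then show ?thesis by (simp only: mult_ac)
  qed
  finally have "2 * real (card \<Phi>) \<le> 2 * ((200 * real k) ^ m * (1 + 1 / (100 * real k)) ^ n * real n ^ (8 * k) *
      (real (num_bounded_spanning_trees k G) *
      ((real n * real n + 1) ^ (80 * k) * (real n + 1) ^ (8 * k))))"
    by (rule mult_left_mono) simp
  with half show ?thesis unfolding n_def m_def by (simp only: mult.assoc)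
qed

end

section \<open>Comparison with \<open>z_star\<close> and the limit\<close>

lemma z_star_nonneg: "0 \<le> z_star k"
  by (simp add: z_star_def)

lemma z_star_le:
  assumes "k \<ge> 1"
  shows "z_star k \<le> exp (- ln (9 * real k) / (7 * real k))"
proof -
  have x: "0 \<le> 1 - 1 / (7 * real k)" "1 - 1 / (7 * real k) \<le> 1" using assms by (auto simp: field_simps)
  have "(1 - 1 / (7 * real k)) powr (1 - 1 / (7 * real k)) \<le> 1"
    using x powr_mono2[of "1 - 1 / (7 * real k)" "1 - 1 / (7 * real k)" 1] by simp
  then have "z_star k \<le> (1 / (9 * real k)) powr (1 / (7 * real k))"
    unfolding z_star_def by (intro mult_left_le_one_le) auto
  also have "\<dots> = exp (- ln (9 * real k) / (7 * real k))"
    using assms by (simp add: powr_def ln_div)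
  finally show ?thesis .
qed

lemma polynomial_le_exp_eventually:
  fixes a :: real
  assumes "a > 0"
  shows "eventually (\<lambda>n. 2 * (real n ^ p * ((real n * real n + 1) ^ q * (real n + 1) ^ r)) \<le> exp (a * real n))
    sequentially"
proof -
  have "eventually (\<lambda>n. ln 2 + real p * ln (real n) + real q * ln (real n * real n + 1) +
      real r * ln (real n + 1) \<le> a * real n) sequentially"
    using assms by real_asymp
  then show ?thesis using eventually_gt_at_top[of 0]
  proof eventually_elim
    case (elim n)
    have "0 < real n * real n + 1" by (simp add: add_nonneg_pos)
    then have "2 * (real n ^ p * ((real n * real n + 1) ^ q * (real n + 1) ^ r)) =
        exp (ln 2 + real p * ln (real n) + real q * ln (real n * real n + 1) + real r * ln (real n + 1))"
      using elim(2) by (simp add: exp_add exp_of_nat_mult)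
    then show ?case using elim(1) by simp
  qed
qed

text \<open>With y = n / (100 k) and l = ln (9 k) \<ge> 1, the three losses are at most exp (3 y l),
  exp y and exp y, together at most exp (5 y l). On the other side \<open>z_star k ^ n\<close> is at
  most exp (- (100 / 7) y l).\<close>

lemma entropy_le_z_star:
  fixes T D P :: real and k n :: nat
  assumes k: "k \<ge> 5" and T: "T \<ge> 0"
    and P0: "P \<ge> 0" and P: "2 * P \<le> exp (1 / (100 * real k) * real n)"
    and D: "D \<le> 2 * (200 * real k) ^ (n div (100 * k)) * (1 + 1 / (100 * real k)) ^ n * P * T"
  shows "D * z_star k ^ n \<le> T"
proof -
  define y where "y = real n / (100 * real k)"
  define l where "l = ln (9 * real k)"
  have y: "y \<ge> 0" by (simp add: y_def)
  have l: "l \<ge> 1"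
  proof -
    have "exp 1 \<le> (3::real)" by (rule exp_le)
    then show ?thesis using k by (simp add: l_def ln_ge_iff)
  qed
  \<comment> \<open>This expresses the cost 200 k per dropped choice through l, the logarithm that
    occurs in \<open>z_star\<close>.\<close>
  have "200 * real k \<le> (9 * real k) ^ 3"
  proof -
    have "200 * real k \<le> 729 * (real k * 1 * 1)" by simp
    also have "\<dots> \<le> 729 * (real k * real k * real k)" using k by (intro mult_left_mono mult_mono) auto
    finally show ?thesis by (simp add: power3_eq_cube)
  qed
  then have "ln (200 * real k) \<le> ln ((9 * real k) ^ 3)" using k by simp
  also have "\<dots> = 3 * l" unfolding l_def ln_realpow by simp
  finally have l200: "ln (200 * real k) \<le> 3 * l" .
  have "(200 * real k) ^ (n div (100 * k)) = exp (real (n div (100 * k)) * ln (200 * real k))"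
    using k by (simp add: exp_of_nat_mult)
  also have "\<dots> \<le> exp (y * (3 * l))"
  proof -
    have "real (n div (100 * k)) \<le> y" using of_nat_div_le_of_nat[of n "100 * k"] by (simp add: y_def)
    then have "real (n div (100 * k)) * ln (200 * real k) \<le> y * (3 * l)"
      using l200 k y by (intro mult_mono) auto
    then show ?thesis by simp
  qed
  finally have e1: "(200 * real k) ^ (n div (100 * k)) \<le> exp (y * (3 * l))" .
  have "(1 + 1 / (100 * real k)) ^ n \<le> exp (1 / (100 * real k)) ^ n"
    using exp_ge_add_one_self by (intro power_mono) auto
  also have "\<dots> = exp y" by (simp add: y_def flip: exp_of_nat_mult)
  finally have e2: "(1 + 1 / (100 * real k)) ^ n \<le> exp y" .
  have e3: "2 * P \<le> exp y" using P by (simp add: y_def)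
  have "z_star k ^ n \<le> exp (- l / (7 * real k)) ^ n"
    using z_star_le[of k] z_star_nonneg k by (intro power_mono) (auto simp: l_def)
  also have "\<dots> = exp (- (100 / 7) * (y * l))" by (simp add: y_def flip: exp_of_nat_mult)
  finally have e4: "z_star k ^ n \<le> exp (- (100 / 7) * (y * l))" .
  have "D \<le> ((200 * real k) ^ (n div (100 * k)) * (1 + 1 / (100 * real k)) ^ n) * (2 * P) * T"
    using D by (simp add: mult_ac)
  also have "\<dots> \<le> (exp (y * (3 * l)) * exp y) * exp y * T"
    using e1 e2 e3 T k P0 by (intro mult_right_mono[OF _ T] mult_mono) auto
  also have "\<dots> = exp (3 * (y * l) + 2 * y) * T" by (simp add: algebra_simps flip: exp_add)
  finally have "D * z_star k ^ n \<le> exp (3 * (y * l) + 2 * y) * T * z_star k ^ n"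
    using z_star_nonneg by (intro mult_right_mono) auto
  also have "\<dots> \<le> exp (3 * (y * l) + 2 * y) * T * exp (- (100 / 7) * (y * l))"
    using e4 T by (intro mult_left_mono) auto
  also have "\<dots> = exp (3 * (y * l) + 2 * y - (100 / 7) * (y * l)) * T"
  proof -
    have "3 * (y * l) + 2 * y - (100 / 7) * (y * l) = 3 * (y * l) + 2 * y + (- (100 / 7) * (y * l))"
      by simp
    then show ?thesis by (simp only: exp_add mult_ac)
  qed
  also have "\<dots> \<le> 1 * T"
  proof (rule mult_right_mono[OF _ T])
    have "2 * y \<le> 2 * (y * l)" using y l by (simp add: mult_le_cancel_left1)
    moreover have "0 \<le> y * l" using y l by simp
    ultimately have "3 * (y * l) + 2 * y - (100 / 7) * (y * l) \<le> 0" by linarith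
    then show "exp (3 * (y * l) + 2 * y - (100 / 7) * (y * l)) \<le> 1" by simp
  qed
  finally show ?thesis by simp
qed

lemma host_graph_pair_graph:
  assumes "pair_graph G"
  shows "host_graph (pverts G) (parcs G)"
proof -
  interpret pair_graph G by fact
  show ?thesis
  proof
    show "parcs G \<subseteq> pverts G \<times> pverts G" using wellformed' by auto
    show "sym (parcs G)" using arcs_symmetric by (auto intro: symI)
  qed (use pair_finite_verts no_loops' in auto)
qed

theorem theorem1p4:
  shows "\<exists>k0::nat. k0 > 0 \<and> (\<forall>k\<ge>k0. \<exists>err :: nat \<Rightarrow> real. err \<longlonglongrightarrow> 0 \<and>
    (\<forall>(G :: 'a pair_pre_digraph) n.
       pair_graph G \<and> connected_graph G \<and> card (pverts G) = n \<and>
       real (min_degree G) \<ge> real n / real k * (1 + 3 * sqrt (ln (real k) / real k)) \<longrightarrow>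
       root n (real (num_bounded_spanning_trees k G))
         \<ge> (1 - err n) * root n (real (degree_prod G)) * z_star k))"
proof -
  have "eventually (\<lambda>k. let s = sqrt (ln (real k) / real k) in
      exp (real k / (1 + 3 * s) * (exp s - 1) - s * (real k - 3)) / s \<le> 1 / (4000 * real k)) sequentially"
    using chernoff_bound_eventually filterlim_real_sequentially by (rule eventually_compose_filterlim)
  then obtain k1 where k1: "\<And>k. k \<ge> k1 \<Longrightarrow> let s = sqrt (ln (real k) / real k) in
      exp (real k / (1 + 3 * s) * (exp s - 1) - s * (real k - 3)) / s \<le> 1 / (4000 * real k)"
    unfolding eventually_sequentially by blast
  show ?thesis
  proof (intro exI[of _ "max 5 k1"] conjI allI impI)
    fix k assume kk: "max 5 k1 \<le> k"
    define s where "s = sqrt (ln (real k) / real k)"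
    have k: "k \<ge> 5" and s: "s > 0" using kk by (auto simp: s_def)
    have num: "exp (real k / (1 + 3 * s) * (exp s - 1) - s * (real k - 3)) / s \<le> 1 / (4000 * real k)"
      using k1[of k] kk by (simp add: s_def Let_def)
    have "eventually (\<lambda>n. real n \<ge> 500000 * real k ^ 3) sequentially" by real_asymp
    moreover have "eventually (\<lambda>n. 3 * s * real n > real k * (80 * real k + 2)) sequentially"
      using s by real_asymp
    moreover have "eventually (\<lambda>n. 2 * (real n ^ (8 * k) *
        ((real n * real n + 1) ^ (80 * k) * (real n + 1) ^ (8 * k))) \<le> exp (1 / (100 * real k) * real n)) sequentially"
      using k by (intro polynomial_le_exp_eventually) auto
    ultimately have "eventually (\<lambda>n. real n \<ge> 500000 * real k ^ 3 \<and> 3 * s * real n > real k * (80 * real k + 2) \<and>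
      2 * (real n ^ (8 * k) * ((real n * real n + 1) ^ (80 * k) * (real n + 1) ^ (8 * k))) \<le> exp (1 / (100 * real k) * real n)) sequentially"
      by eventually_elim blast
    then obtain M where M: "\<And>n. n \<ge> M \<Longrightarrow> real n \<ge> 500000 * real k ^ 3 \<and> 3 * s * real n > real k * (80 * real k + 2) \<and>
      2 * (real n ^ (8 * k) * ((real n * real n + 1) ^ (80 * k) * (real n + 1) ^ (8 * k))) \<le> exp (1 / (100 * real k) * real n)"
      unfolding eventually_sequentially by blast
    \<comment> \<open>From \<open>M\<close> on the inequality holds without any loss; for the
      smaller n the value 1 makes the right-hand side 0. \<open>M\<close> is fixed before
      \<open>G\<close>, so the error is uniform over all graphs.\<close>
    define err where "err n = (if n < M then 1 else 0 :: real)" for n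
    have "err \<longlonglongrightarrow> 0"
      by (rule tendsto_eventually) (auto simp: err_def eventually_sequentially intro!: exI[of _ M])
    moreover have "root n (real (num_bounded_spanning_trees k G)) \<ge>
        (1 - err n) * root n (real (degree_prod G)) * z_star k"
      if G: "pair_graph G" "connected_graph G" "card (pverts G) = n"
        and min: "real (min_degree G) \<ge> real n / real k * (1 + 3 * s)" for G :: "'a pair_pre_digraph" and n
    proof (cases "n < M")
      case False
      interpret host_graph "pverts G" "parcs G" using G(1) by (rule host_graph_pair_graph)
      have ne: "pverts G \<noteq> {}" using G(2) by (rule connected_graph_nonempty)
      have deg: "min_degree G \<le> card (parcs G `` {v})" if "v \<in> pverts G" for v
        using that finite_V by (auto simp: min_degree_def simp flip: degree_eq_card_Image intro: Min_le)
      have conn: "(u, v) \<in> (parcs G)\<^sup>*" if "u \<in> pverts G" "v \<in> pverts G" for u v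
        using connected_graphD[OF G(1,2) that] .
      have prod: "card selections = degree_prod G"
        by (simp add: card_selections degree_prod_def degree_eq_card_Image)
      let ?T = "real (num_bounded_spanning_trees k G)"
      have le: "real (degree_prod G) * z_star k ^ n \<le> ?T"
      proof (rule entropy_le_z_star[OF k])
        show "2 * (real n ^ (8 * k) * ((real n * real n + 1) ^ (80 * k) * (real n + 1) ^ (8 * k))) \<le>
            exp (1 / (100 * real k) * real n)" using M False by simp
        show "real (degree_prod G) \<le> 2 * (200 * real k) ^ (n div (100 * k)) * (1 + 1 / (100 * real k)) ^ n *
            (real n ^ (8 * k) * ((real n * real n + 1) ^ (80 * k) * (real n + 1) ^ (8 * k))) * ?T"
          using degree_prod_le_trees[OF k ne s num deg _ _ _ conn G(1) refl refl] min M[of n] False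
          unfolding G(3) prod by (simp add: mult_ac)
      qed (auto intro!: mult_nonneg_nonneg)
      have n: "n > 0" using ne finite_V G(3) by (auto simp: card_gt_0_iff)
      have "root n (real (degree_prod G)) * z_star k = root n (real (degree_prod G) * z_star k ^ n)"
        using n z_star_nonneg by (simp add: real_root_mult real_root_power_cancel)
      also have "\<dots> \<le> root n ?T" using n le by simp
      finally show ?thesis using False by (simp add: err_def)
    qed (simp add: err_def real_root_ge_zero)
    ultimately show "\<exists>err :: nat \<Rightarrow> real. err \<longlonglongrightarrow> 0 \<and>
      (\<forall>(G :: 'a pair_pre_digraph) n.
         pair_graph G \<and> connected_graph G \<and> card (pverts G) = n \<and>
         real (min_degree G) \<ge> real n / real k * (1 + 3 * sqrt (ln (real k) / real k)) \<longrightarrow>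
         root n (real (num_bounded_spanning_trees k G))
           \<ge> (1 - err n) * root n (real (degree_prod G)) * z_star k)"
      unfolding s_def by blast
  qed simp
qed

end
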